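(* Let $d\geq 1$ and let $a=(a_n)_{n\in\mathbb{Z}^d}$ be an odd sequence with $\sum_n|a_n|<\infty$, and let $f(x)=\sum_{n\in\mathbb{Z}^d\setminus\{0\}}a_n\{n\cdot x\}$ be the associated Davenport series. Assume that $\mathrm{supp}(a)$ is a sparse subset of $\mathbb{Z}^d$ and that $\theta_a\leq 1$. Then for every $x_0\in\mathbb{R}^d$, \[ h_f(x_0)\leq\liminf_{q\to\infty,\ q\in\mathrm{supp}(A)}\frac{\log|A_q|}{\log\delta^{\mathcal{P}}_q(x_0)}\leq\liminf_{n\to\infty,\ n\in\mathrm{supp}(a)}\frac{\log|a_n|}{\log\delta_n(x_0)}. \] Moreover, if $x_0\notin\mathcal{D}(M(a))$, these three quantities coincide, i.e. \[ h_f(x_0)=\liminf_{q\to\infty,\ q\in\mathrm{supp}(A)}\frac{\log|A_q|}{\log\delta^{\mathcal{P}}_q(x_0)}=\liminf_{n\to\infty,\ n\in\mathrm{supp}(a)}\frac{\log|a_n|}{\log\delta_n(x_0)}. \]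
   Context: For $x\in\mathbb{R}$, $\{x\}=x-\lfloor x\rfloor-\tfrac12$ if $x\notin\mathbb{Z}$ and $\{x\}=0$ if $x\in\mathbb{Z}$. A sequence $(a_n)_{n\in\mathbb{Z}^d}$ is odd if $a_{-n}=-a_n$ for all $n$. $n\cdot x$ is the standard inner product and $|n|$ the Euclidean norm. $\mathrm{supp}(a)=\{n: a_n\neq 0\}$. A set $Q\subseteq\mathbb{R}^d$ is sparse if $\lim_{R\to\infty}\log\#(Q\cap B(0,R))/\log R=0$, where $B(0,R)$ is the open ball of radius $R$ centered at $0$. The jump sequence is $A=J(a)$, $A_q=2\sum_{l\geq 1}a_{lq}$ for $q\in\mathbb{Z}^d$. The maximal sequence is $\overline a=M(a)$, $\overline a_q=\sup_{l\geq1}|a_{lq}|$. $\theta_a=\limsup_{q\to\infty,\,q\in\mathrm{supp}(\overline a)}\log|A_q|/\log|\overline a_q|$. For $q\in\mathbb{Z}^d\setminus\{0\}$, $\mathcal{P}(q)$ is the set of integers $p$ such that the gcd of $p$ and the components of $q$ is $1$; $\delta^{\mathcal{P}}_q(x_0)=\frac{1}{|q|}\inf_{p\in\mathcal{P}(q)}|q\cdot x_0-p|$ and $\delta_n(x_0)=\frac1{|n|}\inf_{k\in\mathbb{Z}}|n\cdot x_0-k|$. For $p\in\mathbb{Z}$, $q\in\mathbb{Z}^d\setminus\{0\}$, $H_{p,q}=\{x: q\cdot x=p\}$. $\mathbb{Z}^d_+$ is the set of nonzero integer vectors whose first nonzero coordinate is positive, $\mathcal{H}_d=\{(p,q)\in\mathbb{Z}\times\mathbb{Z}^d_+:\gcd(p,q)=1\}$,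 and for an even or odd sequence $b$, $\mathcal{D}(b)=\bigcup_{(p,q)\in\mathcal{H}_d,\,q\in\mathrm{supp}(b)}H_{p,q}$. Hölder exponent: for locally bounded $f$, $f\in C^\alpha(x_0)$ ($\alpha\ge0$) if there are $C>0$ and a polynomial $P$ of degree $<\alpha$ with $|f(x)-P(x)|\le C|x-x_0|^\alpha$ near $x_0$; $h_f(x_0)=\sup\{\alpha\ge0: f\in C^\alpha(x_0)\}\in[0,\infty]$.
   Formalization: In the second inequality the last liminf runs only over n in supp(a) with δ_n(x_0) ≠ 0: otherwise the quotient is undefined, and read as 0 the inequality fails (d=1, a_{±2^j}=±2^{-j}, x_0=0). The equality part is over all of supp(a). *)

theory Defs
  imports "HOL-Analysis.Analysis"
begin

text \<open>
  The group $\mathbb{Z}^d$ is \<^typ>\<open>int ^ 'd\<close>. The class \<^class>\<open>linorder\<close> on the index type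
  is only used to say which coordinate of a vector comes first.
\<close>

definition rvec :: "int ^ 'd \<Rightarrow> real ^ 'd"
  where "rvec n = (\<chi> i. real_of_int (n $ i))"

definition sawtooth :: "real \<Rightarrow> real"
  where "sawtooth x = (if x \<in> \<int> then 0 else x - of_int \<lfloor>x\<rfloor> - 1/2)"

definition odd_seq :: "(int ^ 'd \<Rightarrow> real) \<Rightarrow> bool"
  where "odd_seq a \<longleftrightarrow> (\<forall>n. a (- n) = - a n)"

definition supp :: "(int ^ 'd \<Rightarrow> real) \<Rightarrow> (int ^ 'd) set"
  where "supp a = {n. a n \<noteq> 0}"

definition davenport :: "(int ^ 'd \<Rightarrow> real) \<Rightarrow> real ^ 'd \<Rightarrow> real"
  where "davenport a x = (\<Sum>\<^sub>\<infinity>n\<in>UNIV - {0}. a n * sawtooth (rvec n \<bullet> x))"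

text \<open>
  The finiteness conjunct guards against \<^const>\<open>card\<close> being \<open>0\<close> on infinite sets. Since
  \<open>ln 0 = 0\<close>, the empty set is sparse.
\<close>

definition sparse_set :: "(real ^ 'd) set \<Rightarrow> bool"
  where "sparse_set Q \<longleftrightarrow> (\<forall>R. finite (Q \<inter> ball 0 R)) \<and>
    ((\<lambda>R. ln (real (card (Q \<inter> ball 0 R))) / ln R) \<longlongrightarrow> 0) at_top"

definition jump_seq :: "(int ^ 'd \<Rightarrow> real) \<Rightarrow> int ^ 'd \<Rightarrow> real"
  where "jump_seq a q = 2 * (\<Sum>\<^sub>\<infinity>l\<in>{1::nat..}. a (int l *s q))"

definition max_seq :: "(int ^ 'd \<Rightarrow> real) \<Rightarrow> int ^ 'd \<Rightarrow> real"
  where "max_seq a q = (SUP l\<in>{1::nat..}. \<bar>a (int l *s q)\<bar>)"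

text \<open>
  Logarithm of a nonnegative number with $\log 0 = -\infty$. Together with the division of
  \<^typ>\<open>ereal\<close>, a quotient of logarithms is \<open>\<infinity>\<close> if its numerator is \<open>-\<infinity>\<close> and its denominator
  is finite and negative, and \<open>0\<close> if its numerator is finite and its denominator is \<open>-\<infinity>\<close>.
\<close>

definition elog :: "real \<Rightarrow> ereal"
  where "elog x = (if x = 0 then -\<infinity> else ereal (ln x))"

definition to_infinity :: "(int ^ 'd) set \<Rightarrow> (int ^ 'd) filter"
  where "to_infinity S = inf (filtercomap (\<lambda>q. norm (rvec q)) at_top) (principal S)"

definition theta :: "(int ^ 'd \<Rightarrow> real) \<Rightarrow> ereal"
  where "theta a = Limsup (to_infinity (supp (max_seq a)))
    (\<lambda>q. elog \<bar>jump_seq a q\<bar> / elog \<bar>max_seq a q\<bar>)"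

definition coprime_ints :: "int ^ 'd \<Rightarrow> int set"
  where "coprime_ints q = {p. Gcd (insert p (range (\<lambda>i. q $ i))) = 1}"

definition delta_P :: "int ^ 'd \<Rightarrow> real ^ 'd \<Rightarrow> real"
  where "delta_P q x = (INF p\<in>coprime_ints q. \<bar>rvec q \<bullet> x - of_int p\<bar>) / norm (rvec q)"

definition delta :: "int ^ 'd \<Rightarrow> real ^ 'd \<Rightarrow> real"
  where "delta n x = (INF k::int. \<bar>rvec n \<bullet> x - of_int k\<bar>) / norm (rvec n)"

definition hyperplane :: "int \<Rightarrow> int ^ 'd \<Rightarrow> (real ^ 'd) set"
  where "hyperplane p q = {x. rvec q \<bullet> x = of_int p}"

definition pos_vecs :: "(int ^ 'd::{finite,linorder}) set"
  where "pos_vecs = {q. \<exists>i. q $ i > 0 \<and> (\<forall>j<i. q $ j = 0)}"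

definition hyp_index :: "(int \<times> (int ^ 'd::{finite,linorder})) set"
  where "hyp_index = {(p, q). q \<in> pos_vecs \<and> p \<in> coprime_ints q}"

definition disc_set :: "(int ^ 'd::{finite,linorder} \<Rightarrow> real) \<Rightarrow> (real ^ 'd::{finite,linorder}) set"
  where "disc_set b = (\<Union>(p, q)\<in>{(p, q) \<in> hyp_index. q \<in> supp b}. hyperplane p q)"

text \<open>
  Real polynomial functions in the coordinates, of total degree \<open>< \<alpha>\<close>. For \<open>\<alpha> = 0\<close> only the
  zero polynomial qualifies.
\<close>

definition poly_degree_less :: "real \<Rightarrow> (real ^ 'd \<Rightarrow> real) \<Rightarrow> bool"
  where "poly_degree_less \<alpha> P \<longleftrightarrow>
    (\<exists>(M :: ('d \<Rightarrow> nat) set) c. finite M \<and> (\<forall>m\<in>M. real (\<Sum>i\<in>UNIV. m i) < \<alpha>) \<and>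
      P = (\<lambda>x. \<Sum>m\<in>M. c m * (\<Prod>i\<in>UNIV. (x $ i) ^ m i)))"

text \<open>
  The case \<open>\<alpha> = 0\<close> is separated because \<open>0 powr 0 = 0\<close>, whereas the bound for \<open>\<alpha> = 0\<close> has to
  be the constant \<open>C\<close> also at the point \<open>x = x0\<close>.
\<close>

definition holder_at :: "real \<Rightarrow> (real ^ 'd \<Rightarrow> real) \<Rightarrow> real ^ 'd \<Rightarrow> bool"
  where "holder_at \<alpha> f x0 \<longleftrightarrow>
    (\<exists>C>0. \<exists>P. poly_degree_less \<alpha> P \<and>
      (\<forall>\<^sub>F x in nhds x0. \<bar>f x - P x\<bar> \<le> C * (if \<alpha> = 0 then 1 else norm (x - x0) powr \<alpha>)))"

definition holder_exponent :: "(real ^ 'd \<Rightarrow> real) \<Rightarrow> real ^ 'd \<Rightarrow> ereal"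
  where "holder_exponent f x0 = (SUP \<alpha>\<in>{\<alpha>. \<alpha> \<ge> 0 \<and> holder_at \<alpha> f x0}. ereal \<alpha>)"

end

theory Submission
  imports Defs
begin

text \<open>
  Upper bound: a generic point \<open>y\<close> of the hyperplane \<open>q \<bullet> x = p\<close> satisfies \<open>n \<bullet> y \<in> \<int>\<close> only for the
  multiples \<open>n\<close> of \<open>q\<close>, so \<open>f\<close> jumps there by \<open>A\<^sub>q\<close> and \<open>f \<in> C\<^sup>\<alpha>(x0)\<close> forces
  \<open>\<bar>A\<^sub>q\<bar> \<le> 2 C \<delta>\<^sup>\<alpha>\<close>, where \<open>\<delta>\<close> is the distance from \<open>x0\<close> to the hyperplane. The two lower limits are
  compared by reducing \<open>n\<close> and the integer nearest to \<open>n \<bullet> x0\<close> to a coprime pair \<open>(p, q)\<close>;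
  \<open>\<theta> \<le> 1\<close> bounds \<open>\<bar>A\<^sub>q\<bar>\<close> from below by almost \<open>\<bar>a\<^sub>n\<bar>\<close>.

  Lower bound: let \<open>\<bar>a\<^sub>n\<bar> \<le> B \<delta>\<^sub>n\<^sup>\<beta>\<close>, \<open>0 < \<alpha> < \<beta>\<close> and \<open>r = \<bar>x - x0\<bar>\<close>. If \<open>\<delta>\<^sub>n > r\<close>, the \<open>n\<close>-th term
  is affine between \<open>x0\<close> and \<open>x\<close>; if \<open>\<delta>\<^sub>n \<le> r\<close>, its coefficient is small. Since \<open>\<delta>\<^sub>n \<le> 1 / \<bar>n\<bar>\<close>, in both
  cases the term deviates from its Taylor polynomial of degree \<open>< \<alpha>\<close> by at most a constant times
  \<open>r\<^bsup>\<alpha>\<^esup> \<bar>n\<bar>\<^bsup>\<alpha> - \<beta>\<^esup>\<close>, and sparseness makes these bounds summable.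
\<close>

section \<open>Integer vectors and summable sequences\<close>

lemma rvec_nth [simp]: "rvec n $ i = real_of_int (n $ i)"
  by (simp add: rvec_def)

lemma rvec_scale: "rvec (k *s n) = real_of_int k *\<^sub>R rvec n"
  by (simp add: vec_eq_iff)

lemma rvec_uminus: "rvec (- n) = - rvec n"
  by (simp add: vec_eq_iff)

lemma inj_rvec: "inj rvec"
  by (auto simp: inj_on_def vec_eq_iff)

lemma rvec_eq_0_iff [simp]: "rvec n = 0 \<longleftrightarrow> n = 0"
  by (simp add: vec_eq_iff)

lemma rvec_0 [simp]: "rvec 0 = 0"
  by simp

lemma norm_rvec_ge_1:
  fixes n :: "int ^ 'd::finite"
  assumes "n \<noteq> 0"
  shows "1 \<le> norm (rvec n)"
proof -
  obtain i where "n $ i \<noteq> 0"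
    using assms by (auto simp: vec_eq_iff)
  then have "1 \<le> \<bar>real_of_int (n $ i)\<bar>"
    by linarith
  also have "\<dots> \<le> norm (rvec n)"
    using component_le_norm_cart[of "rvec n" i] by simp
  finally show ?thesis .
qed

lemma finite_norm_rvec_le: "finite {n :: int ^ 'd::finite. norm (rvec n) \<le> R}"
proof (rule finite_imageD)
  have "vec_nth ` {n :: int ^ 'd. norm (rvec n) \<le> R} \<subseteq> PiE UNIV (\<lambda>_. {-\<lceil>R\<rceil>..\<lceil>R\<rceil>})"
  proof clarify
    fix n :: "int ^ 'd" assume n: "norm (rvec n) \<le> R"
    have "\<bar>real_of_int (n $ i)\<bar> \<le> R" for i
      using component_le_norm_cart[of "rvec n" i] n by simp
    then have "real_of_int \<bar>n $ i\<bar> \<le> of_int \<lceil>R\<rceil>" for i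
      by (metis le_of_int_ceiling of_int_abs order_trans)
    then have "n $ i \<in> {-\<lceil>R\<rceil>..\<lceil>R\<rceil>}" for i
      by (simp only: of_int_le_iff abs_le_iff atLeastAtMost_iff) (simp add: minus_le_iff)
    then show "vec_nth n \<in> PiE UNIV (\<lambda>_. {-\<lceil>R\<rceil>..\<lceil>R\<rceil>})"
      by auto
  qed
  then show "finite (vec_nth ` {n :: int ^ 'd. norm (rvec n) \<le> R})"
    by (rule finite_subset) (simp add: finite_PiE)
  show "inj_on vec_nth {n :: int ^ 'd. norm (rvec n) \<le> R}"
    by (simp add: inj_on_def vec_eq_iff)
qed

text \<open>For finite \<open>S\<close> every property holds eventually, so a lower limit along
  \<open>to_infinity S\<close> is then \<infinity>.\<close>

lemma eventually_to_infinity: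
  "eventually P (to_infinity S) \<longleftrightarrow> (\<exists>R. \<forall>q\<in>S. R \<le> norm (rvec q) \<longrightarrow> P q)"
  unfolding to_infinity_def eventually_inf_principal eventually_filtercomap_at_top_linorder
  by auto

lemma eventually_to_infinity_subset:
  assumes "eventually P (to_infinity T)" "S \<subseteq> T"
  shows "eventually P (to_infinity S)"
  using assms unfolding eventually_to_infinity by blast

section \<open>Tails of absolutely summable sequences\<close>

lemma infsum_tail_less:
  fixes a :: "int ^ 'd::finite \<Rightarrow> real"
  assumes "(\<lambda>n. \<bar>a n\<bar>) summable_on UNIV" "e > 0"
  obtains R where "(\<Sum>\<^sub>\<infinity>n\<in>{n. R \<le> norm (rvec n)}. \<bar>a n\<bar>) < e"
proof -
  obtain X where X: "finite X" "dist (\<Sum>n\<in>X. \<bar>a n\<bar>) (\<Sum>\<^sub>\<infinity>n. \<bar>a n\<bar>) \<le> e / 2"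
    using infsum_finite_approximation[OF assms(1), of "e / 2"] \<open>e > 0\<close> by auto
  obtain R where R: "\<And>n. n \<in> X \<Longrightarrow> norm (rvec n) < R"
  proof -
    have "norm (rvec n) < Max ((\<lambda>n. norm (rvec n)) ` X) + 1" if "n \<in> X" for n
      using that X(1) by (intro le_less_trans[OF Max_ge less_add_one]) auto
    then show ?thesis by (rule that)
  qed
  let ?T = "{n. R \<le> norm (rvec n)}"
  have sT: "(\<lambda>n. \<bar>a n\<bar>) summable_on ?T"
    using assms(1) by (rule summable_on_subset) auto
  have "X \<inter> ?T = {}"
    using R by force
  then have "(\<Sum>n\<in>X. \<bar>a n\<bar>) + (\<Sum>\<^sub>\<infinity>n\<in>?T. \<bar>a n\<bar>) = (\<Sum>\<^sub>\<infinity>n\<in>X \<union> ?T. \<bar>a n\<bar>)"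
    using X(1) sT by (subst infsum_Un_disjoint) auto
  also have "\<dots> \<le> (\<Sum>\<^sub>\<infinity>n. \<bar>a n\<bar>)"
    using assms(1) by (intro infsum_mono_neutral) (auto intro: summable_on_subset)
  finally have "(\<Sum>\<^sub>\<infinity>n\<in>?T. \<bar>a n\<bar>) \<le> e / 2"
    using X(2) unfolding dist_real_def by linarith
  then show ?thesis
    using \<open>e > 0\<close> by (intro that[of R]) linarith
qed

lemma inj_scale_vec: "q \<noteq> 0 \<Longrightarrow> inj_on (\<lambda>l::nat. int l *s q) A"
  by (auto simp: inj_on_def vec_eq_iff)

lemma norm_rvec_le_multiple:
  fixes q :: "int ^ 'd::finite"
  assumes "l \<ge> (1::nat)"
  shows "norm (rvec q) \<le> norm (rvec (int l *s q))"
  using assms mult_right_mono[of 1 "real l" "norm (rvec q)"] by (simp add: rvec_scale)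

text \<open>The positive multiples of \<open>q\<close> are distinct and at least as long as
  \<open>q\<close>, so they all lie in the tail. With the analogous bounds for \<open>a\<close> and
  \<open>max_seq a\<close> below, this makes all three sequences tend to 0 at infinity.\<close>

lemma abs_jump_seq_le_tail:
  fixes a :: "int ^ 'd::finite \<Rightarrow> real"
  assumes "(\<lambda>n. \<bar>a n\<bar>) summable_on UNIV" "q \<noteq> 0" "R \<le> norm (rvec q)"
  shows "\<bar>jump_seq a q\<bar> \<le> 2 * (\<Sum>\<^sub>\<infinity>n\<in>{n. R \<le> norm (rvec n)}. \<bar>a n\<bar>)"
proof -
  let ?h = "\<lambda>l::nat. int l *s q"
  have s: "(\<lambda>l. \<bar>a (?h l)\<bar>) summable_on {1..}"
    using summable_on_reindex[OF inj_scale_vec[OF \<open>q \<noteq> 0\<close>], of "\<lambda>n. \<bar>a n\<bar>" "{1..}"]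
      summable_on_subset[OF assms(1), of "?h ` {1..}"] by (simp add: o_def)
  have "\<bar>\<Sum>\<^sub>\<infinity>l\<in>{1..}. a (?h l)\<bar> \<le> (\<Sum>\<^sub>\<infinity>l\<in>{1..}. \<bar>a (?h l)\<bar>)"
    using norm_infsum_bound[of "\<lambda>l. a (?h l)" "{1..}"] s by simp
  also have "\<dots> = (\<Sum>\<^sub>\<infinity>n\<in>?h ` {1..}. \<bar>a n\<bar>)"
    by (subst infsum_reindex[OF inj_scale_vec[OF \<open>q \<noteq> 0\<close>]]) (simp add: o_def)
  also have "\<dots> \<le> (\<Sum>\<^sub>\<infinity>n\<in>{n. R \<le> norm (rvec n)}. \<bar>a n\<bar>)"
  proof (rule infsum_mono_neutral)
    show "\<bar>a n\<bar> \<le> 0" if "n \<in> ?h ` {1..} - {n. R \<le> norm (rvec n)}" for n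
      using that norm_rvec_le_multiple[of _ q] assms(3) by force
  qed (auto intro: summable_on_subset[OF assms(1)])
  finally show ?thesis
    by (simp add: jump_seq_def)
qed

lemma abs_le_tail:
  fixes a :: "int ^ 'd::finite \<Rightarrow> real"
  assumes "(\<lambda>n. \<bar>a n\<bar>) summable_on UNIV" "R \<le> norm (rvec n)"
  shows "\<bar>a n\<bar> \<le> (\<Sum>\<^sub>\<infinity>n\<in>{n. R \<le> norm (rvec n)}. \<bar>a n\<bar>)"
  using finite_sum_le_infsum[of "\<lambda>n. \<bar>a n\<bar>" "{n. R \<le> norm (rvec n)}" "{n}"]
    summable_on_subset[OF assms(1)] assms(2) by auto

lemma bdd_above_multiples:
  fixes a :: "int ^ 'd::finite \<Rightarrow> real"
  assumes "(\<lambda>n. \<bar>a n\<bar>) summable_on UNIV"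
  shows "bdd_above ((\<lambda>l. \<bar>a (int l *s q)\<bar>) ` {1..})"
  using abs_le_tail[OF assms, of 0] by (intro bdd_aboveI2[where M = "\<Sum>\<^sub>\<infinity>n\<in>{n. 0 \<le> norm (rvec n)}. \<bar>a n\<bar>"]) auto

lemma abs_le_max_seq:
  fixes a :: "int ^ 'd::finite \<Rightarrow> real"
  assumes "(\<lambda>n. \<bar>a n\<bar>) summable_on UNIV" "l \<ge> (1::nat)"
  shows "\<bar>a (int l *s q)\<bar> \<le> max_seq a q"
  unfolding max_seq_def using assms(2) by (intro cSUP_upper bdd_above_multiples assms(1)) auto

lemma max_seq_nonneg:
  fixes a :: "int ^ 'd::finite \<Rightarrow> real"
  assumes "(\<lambda>n. \<bar>a n\<bar>) summable_on UNIV"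
  shows "0 \<le> max_seq a q"
  using abs_le_max_seq[OF assms, of 1 q] by simp

lemma max_seq_le_tail:
  fixes a :: "int ^ 'd::finite \<Rightarrow> real"
  assumes "(\<lambda>n. \<bar>a n\<bar>) summable_on UNIV" "R \<le> norm (rvec q)"
  shows "max_seq a q \<le> (\<Sum>\<^sub>\<infinity>n\<in>{n. R \<le> norm (rvec n)}. \<bar>a n\<bar>)"
  unfolding max_seq_def
proof (rule cSUP_least)
  show "\<bar>a (int l *s q)\<bar> \<le> (\<Sum>\<^sub>\<infinity>n\<in>{n. R \<le> norm (rvec n)}. \<bar>a n\<bar>)" if "l \<in> {1..}" for l
    using that norm_rvec_le_multiple[of l q] assms by (intro abs_le_tail) auto
qed auto

lemma eventually_abs_less:
  fixes a :: "int ^ 'd::finite \<Rightarrow> real"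
  assumes "(\<lambda>n. \<bar>a n\<bar>) summable_on UNIV" "e > 0"
  shows "\<forall>\<^sub>F n in to_infinity S. \<bar>a n\<bar> < e"
proof -
  obtain R where "(\<Sum>\<^sub>\<infinity>n\<in>{n. R \<le> norm (rvec n)}. \<bar>a n\<bar>) < e"
    using assms by (rule infsum_tail_less)
  then show ?thesis
    unfolding eventually_to_infinity using abs_le_tail[OF assms(1)] by (meson le_less_trans)
qed

lemma eventually_max_seq_less:
  fixes a :: "int ^ 'd::finite \<Rightarrow> real"
  assumes "(\<lambda>n. \<bar>a n\<bar>) summable_on UNIV" "e > 0"
  shows "\<forall>\<^sub>F n in to_infinity S. max_seq a n < e"
proof -
  obtain R where "(\<Sum>\<^sub>\<infinity>n\<in>{n. R \<le> norm (rvec n)}. \<bar>a n\<bar>) < e"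
    using assms by (rule infsum_tail_less)
  then show ?thesis
    unfolding eventually_to_infinity using max_seq_le_tail[OF assms(1)] by (meson le_less_trans)
qed

lemma eventually_nonzero: "\<forall>\<^sub>F n in to_infinity S. (n :: int ^ 'd::finite) \<noteq> 0"
  unfolding eventually_to_infinity by (intro exI[of _ 1]) auto

lemma eventually_jump_seq_less:
  fixes a :: "int ^ 'd::finite \<Rightarrow> real"
  assumes "(\<lambda>n. \<bar>a n\<bar>) summable_on UNIV" "e > 0"
  shows "\<forall>\<^sub>F n in to_infinity S. \<bar>jump_seq a n\<bar> < e"
proof -
  obtain R where R: "(\<Sum>\<^sub>\<infinity>n\<in>{n. R \<le> norm (rvec n)}. \<bar>a n\<bar>) < e / 2"
    using infsum_tail_less[OF assms(1), of "e / 2"] assms(2) by auto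
  have "\<forall>\<^sub>F n in to_infinity S. R \<le> norm (rvec n)"
    unfolding eventually_to_infinity by auto
  then show ?thesis
    using eventually_nonzero
  proof eventually_elim
    case (elim n)
    then show ?case
      using abs_jump_seq_le_tail[OF assms(1), of n R] R by simp
  qed
qed

section \<open>Coprime pairs of an integer and an integer vector\<close>

lemma coprime_intsI:
  assumes "\<And>s. s dvd p \<Longrightarrow> (\<And>i. s dvd q $ i) \<Longrightarrow> is_unit s"
  shows "p \<in> coprime_ints q"
proof -
  have "is_unit (Gcd (insert p (range (\<lambda>i. q $ i))))"
    by (rule assms) (auto intro: Gcd_dvd simp del: Gcd_insert)
  then show ?thesis
    by (simp add: coprime_ints_def del: Gcd_insert)
qed

lemma coprime_ints_unit:
  assumes "p \<in> coprime_ints q" "s dvd p" "\<And>i. s dvd q $ i"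
  shows "is_unit s"
proof -
  have "s dvd Gcd (insert p (range (\<lambda>i. q $ i)))"
    using assms by (intro Gcd_greatest) auto
  then show ?thesis
    using assms(1) by (simp add: coprime_ints_def del: Gcd_insert)
qed

text \<open>Division by the gcd \<open>G\<close> of \<open>k\<close> and the components of
  \<open>n\<close>, which is positive because \<open>n\<close> is nonzero, even if
  \<open>k = 0\<close>. The pairs \<open>(k, n)\<close> and \<open>(p, q)\<close> define the same
  hyperplane.\<close>

lemma reduce_to_coprime:
  fixes n :: "int ^ 'd::finite"
  assumes "n \<noteq> 0"
  obtains g :: nat and p q where "g \<ge> 1" "n = int g *s q" "k = int g * p" "p \<in> coprime_ints q" "q \<noteq> 0"
proof -
  define G where "G = Gcd (insert k (range (\<lambda>i. n $ i)))"
  have G_dvd: "G dvd k" "\<And>i. G dvd n $ i"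
    unfolding G_def by (auto intro: Gcd_dvd simp del: Gcd_insert)
  obtain i where "n $ i \<noteq> 0"
    using assms by (auto simp: vec_eq_iff)
  then have "G \<noteq> 0"
    using G_dvd(2)[of i] by auto
  moreover have "G \<ge> 0"
    unfolding G_def by (simp del: Gcd_insert)
  ultimately have "G > 0" by simp
  define q where "q = (\<chi> i. n $ i div G)"
  have n: "n = G *s q"
    using G_dvd(2) by (simp add: q_def vec_eq_iff)
  have k: "k = G * (k div G)"
    using G_dvd(1) by simp
  have "k div G \<in> coprime_ints q"
  proof (rule coprime_intsI)
    fix s assume s: "s dvd k div G" "\<And>i. s dvd q $ i"
    \<comment> \<open>A common divisor \<open>s\<close> of the quotients makes \<open>G * s\<close>
      a common divisor of the original numbers.\<close>
    have "G * s dvd G"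
      unfolding G_def
    proof (rule Gcd_greatest, fold G_def)
      fix b assume "b \<in> insert k (range (\<lambda>i. n $ i))"
      then show "G * s dvd b"
        using s k n by (metis insertE mult_dvd_mono dvd_refl rangeE vector_smult_component)
    qed
    then show "is_unit s"
      using \<open>G \<noteq> 0\<close> by (metis dvd_mult_cancel_left mult.right_neutral)
  qed
  moreover have "q \<noteq> 0"
    using n assms by (auto simp: vec_eq_iff)
  ultimately show ?thesis
    using that[of "nat G" q "k div G"] n k \<open>G > 0\<close> by simp
qed

section \<open>The sawtooth function and dominated convergence\<close>

lemma abs_sawtooth_le: "\<bar>sawtooth x\<bar> \<le> 1 / 2"
proof (cases "x \<in> \<int>")
  case False
  have "of_int \<lfloor>x\<rfloor> \<le> x" "x \<le> of_int \<lfloor>x\<rfloor> + 1"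
    by linarith+
  then show ?thesis
    unfolding sawtooth_def using False by (simp only: if_False abs_le_iff) linarith
qed (simp add: sawtooth_def)

lemma sawtooth_eq:
  assumes "of_int k < x" "x < of_int k + 1"
  shows "sawtooth x = x - of_int k - 1 / 2"
proof -
  have "\<lfloor>x\<rfloor> = k"
    using assms by (intro floor_unique) auto
  moreover have "x \<notin> \<int>"
    using assms by (auto elim!: Ints_cases)
  ultimately show ?thesis
    by (simp add: sawtooth_def)
qed

text \<open>The assumption puts \<open>u\<close> and \<open>v\<close> strictly between the same two
  consecutive integers, where the sawtooth is affine with slope 1.\<close>

lemma sawtooth_diff:
  assumes "\<And>k::int. \<bar>v - u\<bar> < \<bar>u - of_int k\<bar>"
  shows "sawtooth v - sawtooth u = v - u"
proof -
  have "\<bar>v - u\<bar> < u - of_int \<lfloor>u\<rfloor>" "\<bar>v - u\<bar> < of_int \<lfloor>u\<rfloor> + 1 - u"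
    using assms[of "\<lfloor>u\<rfloor>"] assms[of "\<lfloor>u\<rfloor> + 1"] by linarith+
  then have "sawtooth v = v - of_int \<lfloor>u\<rfloor> - 1 / 2" "sawtooth u = u - of_int \<lfloor>u\<rfloor> - 1 / 2"
    by (auto intro!: sawtooth_eq)
  then show ?thesis by simp
qed

text \<open>For small \<open>t > 0\<close> the difference equals \<open>2 * (t * c)\<close> plus the
  claimed limit. At an integer the sawtooth drops from 1/2 to -1/2, and the sign of \<open>c\<close>
  decides on which side each argument lies.\<close>

lemma sawtooth_jump:
  "((\<lambda>t. sawtooth (z + t * c) - sawtooth (z - t * c)) \<longlongrightarrow> (if z \<in> \<int> then - sgn c else 0)) (at_right 0)"
    (is "(_ \<longlongrightarrow> ?J) _")
proof (rule Lim_transform_eventually)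
  have "((\<lambda>t. 2 * (t * c) + ?J) \<longlongrightarrow> 2 * (0 * c) + ?J) (at_right 0)"
    by (intro tendsto_intros)
  then show "((\<lambda>t. 2 * (t * c) + ?J) \<longlongrightarrow> ?J) (at_right 0)"
    by simp
  have small: "\<forall>\<^sub>F t in at_right 0. \<bar>t * c\<bar> < e" if "e > 0" for e :: real
  proof (rule order_tendstoD(2)[OF _ that])
    have "((\<lambda>t. \<bar>t * c\<bar>) \<longlongrightarrow> \<bar>0 * c\<bar>) (at_right 0)"
      by (intro tendsto_intros)
    then show "((\<lambda>t. \<bar>t * c\<bar>) \<longlongrightarrow> 0) (at_right 0)"
      by simp
  qed
  show "\<forall>\<^sub>F t in at_right 0. 2 * (t * c) + ?J = sawtooth (z + t * c) - sawtooth (z - t * c)"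
  proof (cases "z \<in> \<int>")
    case False
    define e where "e = \<bar>z - of_int (round z)\<bar>"
    have "e > 0"
      using False unfolding e_def by (metis Ints_of_int eq_iff_diff_eq_0 zero_less_abs_iff)
    have le: "e \<le> \<bar>z - of_int k\<bar>" for k
      unfolding e_def by (rule round_diff_minimal)
    show ?thesis
      using small[OF \<open>e > 0\<close>]
    proof eventually_elim
      case (elim t)
      have "sawtooth (z + t * c) - sawtooth z = t * c" "sawtooth (z - t * c) - sawtooth z = - (t * c)"
        using sawtooth_diff[of "z + t * c" z] sawtooth_diff[of "z - t * c" z] le elim
        by (simp_all add: less_le_trans)
      then show ?case
        using False by simp
    qed
  next
    case True
    then obtain k where z: "z = of_int k"
      by (auto elim: Ints_cases)
    show ?thesis
      using small[OF zero_less_one] eventually_at_right_less[of 0]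
    proof eventually_elim
      case (elim t)
      \<comment> \<open>The two arguments lie in the unit intervals starting at \<open>k\<close> and
        \<open>k - 1\<close>, with values \<open>s - 1/2\<close> and \<open>1/2 - s\<close>. For
        \<open>c < 0\<close> this is used with \<open>s = - (t * c)\<close>.\<close>
      have *: "sawtooth (z + s) - sawtooth (z - s) = 2 * s - 1" if "0 < s" "s < 1" for s
        using sawtooth_eq[of k "z + s"] sawtooth_eq[of "k - 1" "z - s"] that z by simp
      consider "c = 0" | "c > 0" | "c < 0" by linarith
      then show ?case
      proof cases
        case 1
        then show ?thesis by simp
      next
        case 2
        then show ?thesis
          using *[of "t * c"] elim True by simp
      next
        case 3
        then have "t * c < 0"
          using elim by (simp add: mult_pos_neg)
        then show ?thesis
          using *[of "- (t * c)"] elim True 3 by simp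
      qed
    qed
  qed
qed

section \<open>Dominated convergence for infinite sums\<close>

lemma summable_on_real_comparison:
  fixes f h :: "'a \<Rightarrow> real"
  assumes "h summable_on A" "\<And>n. n \<in> A \<Longrightarrow> \<bar>f n\<bar> \<le> h n"
  shows "f summable_on A"
  by (rule abs_summable_summable, rule summable_on_comparison_test[OF assms(1)])
    (use assms(2) in auto)

text \<open>A finite \<open>X\<close> carries all but \<open>e / 4\<close> of the dominating sum.
  The sums over \<open>X\<close> are eventually within \<open>e / 4\<close> of each other, and each
  of the two remainders contributes at most another \<open>e / 4\<close>.\<close>

lemma tendsto_infsum_dominated:
  fixes f :: "'a \<Rightarrow> 'b \<Rightarrow> real"
  assumes h: "h summable_on A" and le: "\<And>n t. n \<in> A \<Longrightarrow> \<bar>f n t\<bar> \<le> h n"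
    and lim: "\<And>n. n \<in> A \<Longrightarrow> (f n \<longlongrightarrow> g n) F"
  shows "((\<lambda>t. \<Sum>\<^sub>\<infinity>n\<in>A. f n t) \<longlongrightarrow> (\<Sum>\<^sub>\<infinity>n\<in>A. g n)) F"
proof (cases "F = bot")
  case False
  \<comment> \<open>The domination passes to the limit only along a nontrivial filter, hence the
    case distinction.\<close>
  have le_g: "\<bar>g n\<bar> \<le> h n" if "n \<in> A" for n
    using tendsto_upperbound[OF tendsto_rabs[OF lim[OF that]], of "h n"] le[OF that] False by simp
  have sums: "(\<lambda>n. f n t) summable_on B" "g summable_on B" "h summable_on B" if "B \<subseteq> A" for B t
  proof -
    show hB: "h summable_on B"
      using h that by (rule summable_on_subset)
    show "(\<lambda>n. f n t) summable_on B" "g summable_on B"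
      by (rule summable_on_real_comparison[OF hB]; use that le le_g in force)+
  qed
  have bound: "\<bar>(\<Sum>\<^sub>\<infinity>n\<in>B. u n)\<bar> \<le> (\<Sum>\<^sub>\<infinity>n\<in>B. h n)" if "B \<subseteq> A" "u summable_on B" "\<And>n. n \<in> B \<Longrightarrow> \<bar>u n\<bar> \<le> h n" for B u
    using norm_infsum_le[OF has_sum_infsum[OF that(2)] has_sum_infsum[OF sums(3)[OF that(1)]]] that(3) by simp
  show ?thesis
  proof (rule tendstoI)
    fix e :: real assume "e > 0"
    obtain X where X: "finite X" "X \<subseteq> A" "dist (sum h X) (infsum h A) \<le> e / 4"
      using infsum_finite_approximation[OF h, of "e / 4"] \<open>e > 0\<close> by auto
    have split: "infsum u A = sum u X + infsum u (A - X)" if "u summable_on A" for u :: "'a \<Rightarrow> real"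
      using infsum_Un_disjoint[of u X "A - X"] X(1,2) summable_on_subset[OF that, of "A - X"]
      by (simp add: Un_absorb1)
    have tail: "infsum h (A - X) \<le> e / 4"
      using X(3) split[OF h] unfolding dist_real_def by linarith
    have "((\<lambda>t. \<Sum>n\<in>X. f n t) \<longlongrightarrow> (\<Sum>n\<in>X. g n)) F"
      using X(2) lim by (intro tendsto_sum) auto
    then have "\<forall>\<^sub>F t in F. dist (\<Sum>n\<in>X. f n t) (\<Sum>n\<in>X. g n) < e / 4"
      using \<open>e > 0\<close> by (intro tendstoD) auto
    then show "\<forall>\<^sub>F t in F. dist (\<Sum>\<^sub>\<infinity>n\<in>A. f n t) (\<Sum>\<^sub>\<infinity>n\<in>A. g n) < e"
    proof eventually_elim
      case (elim t)
      have "\<bar>\<Sum>\<^sub>\<infinity>n\<in>A - X. f n t\<bar> \<le> e / 4" "\<bar>\<Sum>\<^sub>\<infinity>n\<in>A - X. g n\<bar> \<le> e / 4"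
        using bound[of "A - X" "\<lambda>n. f n t"] bound[of "A - X" g] sums[of "A - X"] le le_g tail by force+
      then show ?case
        using elim split[OF sums(1)[OF subset_refl], of t] split[OF sums(2)[OF subset_refl]] \<open>e > 0\<close>
        unfolding dist_real_def by linarith
    qed
  qed
qed simp

section \<open>Jumps of the Davenport series\<close>

text \<open>The factor \<open>c\<close> is rational, as \<open>q\<close> has a nonzero component. In
  lowest terms its denominator divides \<open>p\<close> and every component of \<open>q\<close>, so
  it is a unit.\<close>

lemma integer_multiple_of_coprime:
  fixes n q :: "int ^ 'd::finite"
  assumes "q \<noteq> 0" "p \<in> coprime_ints q" "rvec n = c *\<^sub>R rvec q" "c * of_int p \<in> \<int>"
  shows "\<exists>l::int. n = l *s q"
proof -
  have n: "of_int (n $ i) = c * of_int (q $ i)" for i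
    using assms(3) by (metis real_scaleR_def rvec_nth vector_scaleR_component)
  obtain i where "q $ i \<noteq> 0"
    using assms(1) by (auto simp: vec_eq_iff)
  then have "c = of_int (n $ i) / of_int (q $ i)"
    using n[of i] by simp
  then have "c \<in> \<rat>" by simp
  then obtain r s where rs: "s > 0" "coprime r s" "c = of_int r / of_int s"
    by (rule Rats_cases')
  obtain m where m: "c * of_int p = of_int m"
    using assms(4) by (auto elim: Ints_cases)
  have "of_int (s * m) = (of_int (r * p) :: real)"
    using m rs by (simp add: field_simps)
  then have "s dvd r * p"
    by (metis dvd_triv_left of_int_eq_iff)
  moreover have "s dvd r * q $ i" for i
  proof -
    have "of_int (s * n $ i) = (of_int (r * q $ i) :: real)"
      using n[of i] rs by (simp add: field_simps)
    then show ?thesis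
      by (metis dvd_triv_left of_int_eq_iff)
  qed
  ultimately have "s dvd p" "\<And>i. s dvd q $ i"
    using rs(2) by (auto simp: coprime_dvd_mult_right_iff coprime_commute)
  then have "is_unit s"
    using coprime_ints_unit[OF assms(2)] by blast
  then have "c = of_int r"
    using rs by simp
  then have "n = r *s q"
    using n by (simp add: vec_eq_iff flip: of_int_mult)
  then show ?thesis ..
qed

text \<open>For each \<open>n\<close> not parallel to \<open>q\<close>, the points of the hyperplane
  with \<open>rvec n \<bullet> y\<close> integral lie in countably many lower-dimensional slices,
  which a small perturbation of \<open>y0\<close> avoids. A parallel \<open>n\<close> is an integer
  multiple of \<open>q\<close> by coprimality of \<open>(p, q)\<close>.\<close>

lemma exists_generic_point:
  fixes q :: "int ^ 'd::finite" and y0 :: "real ^ 'd"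
  assumes "q \<noteq> 0" "p \<in> coprime_ints q" "rvec q \<bullet> y0 = of_int p" "e > 0"
  obtains y where "rvec q \<bullet> y = of_int p" "dist y y0 < e"
    "\<And>n. rvec n \<bullet> y \<in> \<int> \<Longrightarrow> \<exists>l::int. n = l *s q"
proof -
  let ?q = "rvec q"
  have qq: "?q \<bullet> ?q > 0"
    using assms(1) by simp
  \<comment> \<open>\<open>pr\<close> is the orthogonal projection along \<open>q\<close>. Letting
    \<open>z\<close> range over the whole space and perturbing by \<open>pr z\<close> allows the use
    of full-dimensional null sets instead of a measure on the hyperplane.\<close>
  define pr where "pr = (\<lambda>z. z - ((?q \<bullet> z) / (?q \<bullet> ?q)) *\<^sub>R ?q)"
  have inner_pr: "v \<bullet> pr z = pr v \<bullet> z" for v z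
    by (simp add: pr_def inner_diff_left inner_diff_right inner_commute)
  define Z where "Z = (\<lambda>(n, k). {z. pr (rvec n) \<bullet> z = of_int k - rvec n \<bullet> y0})
    ` ({n. pr (rvec n) \<noteq> 0} \<times> (UNIV :: int set))"
  have "countable (UNIV :: (int ^ 'd) set)"
  proof -
    have "UNIV = (\<Union>R::nat. {n :: int ^ 'd. norm (rvec n) \<le> real R})"
      using real_arch_simple by auto
    also have "countable \<dots>"
      by (intro countable_UN) (auto intro: countable_finite finite_norm_rvec_le)
    finally show ?thesis .
  qed
  then have "negligible (\<Union>Z)"
    unfolding Z_def
    by (intro negligible_countable_Union countable_image countable_SIGMA)
      (auto intro: negligible_hyperplane countable_subset)
  moreover have "\<not> negligible (ball (0 :: real ^ 'd) e)"
    using open_not_negligible[of "ball (0 :: real ^ 'd) e"] \<open>e > 0\<close> by auto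
  ultimately obtain z where z: "z \<in> ball 0 e" "z \<notin> \<Union>Z"
    using negligible_subset by blast
  let ?y = "y0 + pr z"
  show ?thesis
  proof (rule that[of ?y])
    have "pr ?q = 0"
      using qq by (simp add: pr_def)
    then show qy: "?q \<bullet> ?y = of_int p"
      using assms(3) by (simp add: inner_add_right inner_pr)
    have "norm (pr z) ^ 2 = norm z ^ 2 - (?q \<bullet> z)\<^sup>2 / (?q \<bullet> ?q)"
      unfolding power2_norm_eq_inner using qq
      by (simp add: pr_def inner_diff_left inner_diff_right inner_commute power2_eq_square)
    also have "\<dots> \<le> norm z ^ 2"
      using qq by simp
    finally have "norm (pr z) \<le> norm z"
      by (rule power2_le_imp_le) simp
    then show "dist ?y y0 < e"
      using z(1) by (simp add: dist_norm)
    fix n assume n: "rvec n \<bullet> ?y \<in> \<int>"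
    then obtain k where k: "rvec n \<bullet> ?y = of_int k"
      by (auto elim: Ints_cases)
    have "pr (rvec n) = 0"
    proof (rule ccontr)
      assume "pr (rvec n) \<noteq> 0"
      then have "{z. pr (rvec n) \<bullet> z = of_int k - rvec n \<bullet> y0} \<in> Z"
        unfolding Z_def by force
      moreover have "pr (rvec n) \<bullet> z = of_int k - rvec n \<bullet> y0"
        using k by (simp add: inner_add_right inner_pr)
      ultimately show False
        using z(2) by blast
    qed
    then obtain c where c: "rvec n = c *\<^sub>R ?q"
      unfolding pr_def by (metis eq_iff_diff_eq_0)
    have "rvec n \<bullet> ?y = c * of_int p"
      by (simp only: c inner_scaleR_left qy)
    then show "\<exists>l::int. n = l *s q"
      using integer_multiple_of_coprime[OF assms(1,2) c] n by simp
  qed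
qed

lemma summable_davenport:
  assumes "(\<lambda>n. \<bar>a n\<bar>) summable_on UNIV"
  shows "(\<lambda>n. a n * sawtooth (rvec n \<bullet> x)) summable_on A"
proof (rule summable_on_real_comparison)
  show "(\<lambda>n. \<bar>a n\<bar>) summable_on A"
    using assms by (rule summable_on_subset) simp
  show "\<bar>a n * sawtooth (rvec n \<bullet> x)\<bar> \<le> \<bar>a n\<bar>" for n
    using mult_left_mono[of "\<bar>sawtooth (rvec n \<bullet> x)\<bar>" 1 "\<bar>a n\<bar>"] abs_sawtooth_le[of "rvec n \<bullet> x"]
    by (simp add: abs_mult)
qed

lemma davenport_diff:
  assumes "(\<lambda>n. \<bar>a n\<bar>) summable_on UNIV"
  shows "davenport a x - davenport a y =
    (\<Sum>\<^sub>\<infinity>n\<in>UNIV - {0}. a n * (sawtooth (rvec n \<bullet> x) - sawtooth (rvec n \<bullet> y)))"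
proof -
  have "(\<Sum>\<^sub>\<infinity>n\<in>UNIV - {0}. a n * sawtooth (rvec n \<bullet> x) + - (a n * sawtooth (rvec n \<bullet> y)))
    = davenport a x + - davenport a y"
    unfolding davenport_def infsum_uminus[symmetric]
    by (intro infsum_add summable_davenport assms iffD2[OF summable_on_uminus])
  then show ?thesis
    by (simp add: right_diff_distrib)
qed

lemma abs_sawtooth_diff_le: "\<bar>sawtooth x - sawtooth y\<bar> \<le> 1"
  using abs_sawtooth_le[of x] abs_sawtooth_le[of y] by linarith

text \<open>Each term jumps separately, and \<open>\<bar>a n\<bar>\<close> dominates, so the limit
  may be taken under the sum. By genericity only the nonzero multiples of \<open>q\<close>
  contribute.\<close>

lemma davenport_jump:
  fixes a :: "int ^ 'd::finite \<Rightarrow> real"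
  assumes odd: "odd_seq a" and summable: "(\<lambda>n. \<bar>a n\<bar>) summable_on UNIV"
    and "q \<noteq> 0" and qy: "rvec q \<bullet> y \<in> \<int>"
    and generic: "\<And>n. rvec n \<bullet> y \<in> \<int> \<Longrightarrow> \<exists>l::int. n = l *s q"
  shows "((\<lambda>t. davenport a (y + t *\<^sub>R rvec q) - davenport a (y - t *\<^sub>R rvec q))
    \<longlongrightarrow> - jump_seq a q) (at_right 0)"
proof -
  let ?q = "rvec q"
  let ?h = "\<lambda>l::nat. int l *s q"
  let ?S = "?h ` {1..}" and ?T = "(\<lambda>l. - ?h l) ` {1..}"
  define g where "g = (\<lambda>n. a n * (if rvec n \<bullet> y \<in> \<int> then - sgn (rvec n \<bullet> ?q) else 0))"
  have qq: "?q \<bullet> ?q > 0"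
    using \<open>q \<noteq> 0\<close> by simp
  have "((\<lambda>t. \<Sum>\<^sub>\<infinity>n\<in>UNIV - {0}. a n * (sawtooth (rvec n \<bullet> y + t * (rvec n \<bullet> ?q))
      - sawtooth (rvec n \<bullet> y - t * (rvec n \<bullet> ?q)))) \<longlongrightarrow> (\<Sum>\<^sub>\<infinity>n\<in>UNIV - {0}. g n)) (at_right 0)"
  proof (rule tendsto_infsum_dominated)
    show "(\<lambda>n. \<bar>a n\<bar>) summable_on UNIV - {0}"
      using summable by (rule summable_on_subset) simp
    show "\<bar>a n * (sawtooth u - sawtooth v)\<bar> \<le> \<bar>a n\<bar>" for n u v
      using mult_left_mono[OF abs_sawtooth_diff_le, of "\<bar>a n\<bar>" u v] by (simp add: abs_mult)
  qed (auto simp only: g_def intro!: tendsto_mult_left sawtooth_jump)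
  moreover have "(\<Sum>\<^sub>\<infinity>n\<in>UNIV - {0}. g n) = - jump_seq a q"
  proof -
    \<comment> \<open>For the opposite vectors both the sign of the inner product with
      \<open>q\<close> and the coefficient change, so the two contributions agree. Each half of the
      multiples therefore gives \<open>- jump_seq a q / 2\<close>.\<close>
    have gS: "g (?h l) = - a (?h l)" and gT: "g (- ?h l) = - a (?h l)" if "l \<ge> 1" for l
    proof -
      have "rvec (?h l) \<bullet> y \<in> \<int>"
        using qy by (simp add: rvec_scale)
      then show "g (?h l) = - a (?h l)" "g (- ?h l) = - a (?h l)"
        using odd qq that by (simp_all add: g_def rvec_scale rvec_uminus odd_seq_def sgn_mult)
    qed
    have inj: "inj_on ?h {1..}" "inj_on (\<lambda>l. - ?h l) {1..}"
      using inj_scale_vec[OF \<open>q \<noteq> 0\<close>, of "{1..}"] by (simp_all add: inj_on_def)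
    have "a summable_on ?S"
      by (rule summable_on_real_comparison[OF summable_on_subset[OF summable]]) auto
    then have "(\<lambda>l. a (?h l)) summable_on {1..}"
      unfolding summable_on_reindex[OF inj(1)] o_def .
    then have "((\<lambda>l. a (?h l)) has_sum (jump_seq a q / 2)) {1..}"
      by (simp add: jump_seq_def)
    then have s: "((\<lambda>l. - a (?h l)) has_sum - (jump_seq a q / 2)) {1..}"
      by (rule has_sum_uminusI)
    have S: "(g has_sum - (jump_seq a q / 2)) ?S"
      unfolding has_sum_reindex[OF inj(1)] o_def using s by (rule has_sum_cong[THEN iffD1, rotated]) (simp add: gS)
    have T: "(g has_sum - (jump_seq a q / 2)) ?T"
      unfolding has_sum_reindex[OF inj(2)] o_def using s by (rule has_sum_cong[THEN iffD1, rotated]) (simp add: gT)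
    have disj: "?S \<inter> ?T = {}"
    proof -
      have "?h l \<noteq> - ?h k" if "l \<ge> 1" for l k
      proof
        assume eq: "?h l = - ?h k"
        obtain i where "q $ i \<noteq> 0"
          using \<open>q \<noteq> 0\<close> by (auto simp: vec_eq_iff)
        moreover have "(int l + int k) * q $ i = 0"
          using arg_cong[OF eq, of "\<lambda>v. v $ i"] by (simp add: distrib_right)
        ultimately show False
          using that by simp
      qed
      then show ?thesis by auto
    qed
    have "infsum g (UNIV - {0}) = infsum g (?S \<union> ?T)"
    proof (rule infsum_cong_neutral)
      fix n assume n: "n \<in> UNIV - {0} - (?S \<union> ?T)"
      show "g n = 0"
      proof (rule ccontr)
        assume "g n \<noteq> 0"
        then have "rvec n \<bullet> y \<in> \<int>"
          by (auto simp: g_def split: if_splits)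
        then obtain l :: int where l: "n = l *s q"
          using generic by blast
        consider "l = 0" | "l \<ge> 1" | "l \<le> -1" by linarith
        then show False
        proof cases
          case 1
          then show ?thesis using l n by simp
        next
          case 2
          then have "n = ?h (nat l)" "nat l \<ge> 1"
            using l by auto
          then show ?thesis using n by blast
        next
          case 3
          then have "n = - ?h (nat (- l))" "nat (- l) \<ge> 1"
            using l by (auto simp: vec_eq_iff)
          then show ?thesis using n by blast
        qed
      qed
    next
      fix n assume n: "n \<in> ?S \<union> ?T - (UNIV - {0})"
      then show "g n = 0"
        by (simp add: g_def)
    qed simp
    also have "\<dots> = - jump_seq a q"
      using infsumI[OF has_sum_Un_disjoint[OF S T disj]] by simp
    finally show ?thesis .
  qed
  ultimately show ?thesis
    by (simp add: davenport_diff[OF summable] inner_add_right inner_diff_right)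
qed

lemma poly_degree_less_continuous_on:
  assumes "poly_degree_less \<alpha> P"
  shows "continuous_on S (P :: real ^ 'd::finite \<Rightarrow> real)"
proof -
  obtain M :: "('d \<Rightarrow> nat) set" and c where P: "P = (\<lambda>x. \<Sum>m\<in>M. c m * (\<Prod>i\<in>UNIV. (x $ i) ^ m i))"
    using assms unfolding poly_degree_less_def by blast
  show ?thesis
    unfolding P by (intro continuous_intros)
qed

text \<open>\<open>D\<close> is the distance from \<open>x0\<close> to the hyperplane. Near a
  generic point the two sides of the jump both satisfy the Hoelder bound and the continuous
  \<open>P\<close> cancels. Generic points then approach the foot of the perpendicular from
  \<open>x0\<close>.\<close>

lemma abs_jump_seq_le:
  fixes a :: "int ^ 'd::finite \<Rightarrow> real"
  assumes a: "odd_seq a" "(\<lambda>n. \<bar>a n\<bar>) summable_on UNIV"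
    and q: "q \<noteq> 0" "p \<in> coprime_ints q" and "\<alpha> > 0" and P: "continuous_on UNIV P"
    and f: "\<And>x. dist x x0 < r \<Longrightarrow> \<bar>davenport a x - P x\<bar> \<le> C * norm (x - x0) powr \<alpha>"
    and D: "D = \<bar>rvec q \<bullet> x0 - of_int p\<bar> / norm (rvec q)" "D < r"
  shows "\<bar>jump_seq a q\<bar> \<le> 2 * C * D powr \<alpha>"
proof -
  let ?q = "rvec q" and ?f = "davenport a"
  have qq: "?q \<bullet> ?q > 0"
    using q by simp
  have tendsto_bound: "((\<lambda>t. C * norm (u t - x0) powr \<alpha>) \<longlongrightarrow> C * norm (v - x0) powr \<alpha>) F"
    if "(u \<longlongrightarrow> v) F" for u v and F :: "'e filter"
    using \<open>\<alpha> > 0\<close> that by (intro tendsto_intros tendsto_powr') auto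
  have generic_bound: "\<bar>jump_seq a q\<bar> \<le> 2 * (C * norm (y - x0) powr \<alpha>)"
    if y: "dist y x0 < r" "?q \<bullet> y = of_int p" "\<And>n. rvec n \<bullet> y \<in> \<int> \<Longrightarrow> \<exists>l::int. n = l *s q" for y
  proof -
    have lims: "((\<lambda>t. y + t *\<^sub>R ?q) \<longlongrightarrow> y) (at_right 0)" "((\<lambda>t. y - t *\<^sub>R ?q) \<longlongrightarrow> y) (at_right 0)"
      by (auto intro!: tendsto_eq_intros)
    have "isCont P y"
      using P by (simp add: continuous_on_eq_continuous_at)
    then have P_lims: "((\<lambda>t. P (y + t *\<^sub>R ?q)) \<longlongrightarrow> P y) (at_right 0)"
      "((\<lambda>t. P (y - t *\<^sub>R ?q)) \<longlongrightarrow> P y) (at_right 0)"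
      using lims by (auto intro: isCont_tendsto_compose)
    let ?R = "\<lambda>t. C * norm (y + t *\<^sub>R ?q - x0) powr \<alpha> + C * norm (y - t *\<^sub>R ?q - x0) powr \<alpha>
      + \<bar>P (y + t *\<^sub>R ?q) - P (y - t *\<^sub>R ?q)\<bar>"
    have "\<bar>- jump_seq a q\<bar> \<le> C * norm (y - x0) powr \<alpha> + C * norm (y - x0) powr \<alpha> + \<bar>P y - P y\<bar>"
    proof (rule tendsto_le)
      show "((\<lambda>t. \<bar>?f (y + t *\<^sub>R ?q) - ?f (y - t *\<^sub>R ?q)\<bar>) \<longlongrightarrow> \<bar>- jump_seq a q\<bar>) (at_right 0)"
        using y by (intro tendsto_rabs davenport_jump a q) auto
      show "(?R \<longlongrightarrow> C * norm (y - x0) powr \<alpha> + C * norm (y - x0) powr \<alpha> + \<bar>P y - P y\<bar>) (at_right 0)"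
        by (intro tendsto_add tendsto_rabs tendsto_diff tendsto_bound lims P_lims)
      have "\<forall>\<^sub>F t in at_right 0. dist (y + t *\<^sub>R ?q) x0 < r" "\<forall>\<^sub>F t in at_right 0. dist (y - t *\<^sub>R ?q) x0 < r"
        using y(1) by (auto intro: order_tendstoD(2)[OF tendsto_dist[OF lims(1) tendsto_const]]
            order_tendstoD(2)[OF tendsto_dist[OF lims(2) tendsto_const]])
      then show "\<forall>\<^sub>F t in at_right 0. \<bar>?f (y + t *\<^sub>R ?q) - ?f (y - t *\<^sub>R ?q)\<bar> \<le> ?R t"
      proof eventually_elim
        case (elim t)
        then show ?case
          using f[of "y + t *\<^sub>R ?q"] f[of "y - t *\<^sub>R ?q"] by linarith
      qed
    qed simp
    then show ?thesis by simp
  qed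
  \<comment> \<open>The orthogonal projection of \<open>x0\<close> onto the hyperplane; it need not
    be generic itself.\<close>
  define y0 where "y0 = x0 - ((?q \<bullet> x0 - of_int p) / (?q \<bullet> ?q)) *\<^sub>R ?q"
  have qy0: "?q \<bullet> y0 = of_int p"
    using qq by (simp add: y0_def inner_diff_right)
  have norm_y0: "norm (y0 - x0) = D"
    using q by (simp add: y0_def D(1) dot_square_norm power2_eq_square)
  have "\<exists>y. ?q \<bullet> y = of_int p \<and> dist y y0 < 1 / Suc k \<and> (\<forall>n. rvec n \<bullet> y \<in> \<int> \<longrightarrow> (\<exists>l::int. n = l *s q))" for k
    using exists_generic_point[OF q qy0, of "1 / Suc k"] by (metis divide_pos_pos of_nat_0_less_iff zero_less_Suc zero_less_one)
  then obtain y where y: "\<And>k. ?q \<bullet> y k = of_int p" "\<And>k. dist (y k) y0 < 1 / Suc k"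
    "\<And>k n. rvec n \<bullet> y k \<in> \<int> \<Longrightarrow> \<exists>l::int. n = l *s q"
    by metis
  have y_lim: "y \<longlonglongrightarrow> y0"
    unfolding tendsto_dist_iff[of y]
    by (rule tendsto_sandwich[OF _ _ tendsto_const LIMSEQ_inverse_real_of_nat])
      (auto intro!: always_eventually less_imp_le[OF y(2)] simp: inverse_eq_divide simp del: of_nat_Suc)
  have "\<bar>jump_seq a q\<bar> \<le> 2 * (C * norm (y0 - x0) powr \<alpha>)"
  proof (rule tendsto_lowerbound)
    show "(\<lambda>k. 2 * (C * norm (y k - x0) powr \<alpha>)) \<longlonglongrightarrow> 2 * (C * norm (y0 - x0) powr \<alpha>)"
      by (intro tendsto_mult tendsto_const tendsto_bound y_lim)
    have "\<forall>\<^sub>F k in sequentially. dist (y k) x0 < r"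
      using D(2) norm_y0 by (intro order_tendstoD(2)[OF tendsto_dist[OF y_lim tendsto_const]]) (simp add: dist_norm)
    then show "\<forall>\<^sub>F k in sequentially. \<bar>jump_seq a q\<bar> \<le> 2 * (C * norm (y k - x0) powr \<alpha>)"
      by eventually_elim (rule generic_bound, use y in auto)
  qed simp
  then show ?thesis
    by (simp add: norm_y0)
qed

section \<open>Distances to hyperplanes\<close>

text \<open>With \<open>G\<close> the gcd of the components of \<open>q\<close>, every integer
  congruent to 1 modulo \<open>G\<close> is coprime to \<open>q\<close>. These integers have spacing
  \<open>G\<close>, which is at most the norm of \<open>q\<close>.\<close>

lemma exists_near_coprime_int:
  fixes q :: "int ^ 'd::finite"
  assumes "q \<noteq> 0"
  obtains p where "p \<in> coprime_ints q" "\<bar>z - of_int p\<bar> \<le> norm (rvec q) / 2"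
proof -
  define G where "G = Gcd (range (\<lambda>i. q $ i))"
  obtain i where i: "q $ i \<noteq> 0"
    using assms by (auto simp: vec_eq_iff)
  have G_dvd: "G dvd q $ i" for i
    unfolding G_def by (auto intro: Gcd_dvd)
  have "G \<ge> 0"
    unfolding G_def by simp
  with G_dvd[of i] i have "G > 0"
    by (cases "G = 0") auto
  have "G \<le> \<bar>q $ i\<bar>"
    using zdvd_imp_le[of G "\<bar>q $ i\<bar>"] G_dvd[of i] i by simp
  then have "of_int G \<le> \<bar>rvec q $ i\<bar>"
    by (metis of_int_abs of_int_le_iff rvec_nth)
  also have "\<dots> \<le> norm (rvec q)"
    by (rule component_le_norm_cart)
  finally have G_le: "of_int G \<le> norm (rvec q)" .
  define w where "w = (z - 1) / of_int G"
  define p where "p = 1 + G * round w"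
  show ?thesis
  proof
    show "p \<in> coprime_ints q"
    proof (rule coprime_intsI)
      fix s assume s: "s dvd p" "\<And>i. s dvd q $ i"
      then have "s dvd G"
        unfolding G_def by (auto intro: Gcd_greatest)
      then show "is_unit s"
        using s(1) unfolding p_def by (metis dvd_add_left_iff dvd_mult2)
    qed
    have "of_int G * w = z - 1"
      using \<open>G > 0\<close> by (simp add: w_def)
    then have "z - of_int p = of_int G * (w - of_int (round w))"
      by (simp add: p_def algebra_simps)
    then have "\<bar>z - of_int p\<bar> = of_int G * \<bar>w - of_int (round w)\<bar>"
      using \<open>G > 0\<close> by (simp add: abs_mult)
    also have "\<dots> \<le> of_int G * (1 / 2)"
      using \<open>G > 0\<close> of_int_round_abs_le[of w] by (intro mult_left_mono) (auto simp: abs_minus_commute)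
    finally show "\<bar>z - of_int p\<bar> \<le> norm (rvec q) / 2"
      using G_le by simp
  qed
qed

lemma delta_P_le:
  assumes "p \<in> coprime_ints q"
  shows "delta_P q x \<le> \<bar>rvec q \<bullet> x - of_int p\<bar> / norm (rvec q)"
  unfolding delta_P_def using assms
  by (intro divide_right_mono cINF_lower) (auto intro: bdd_belowI[where m = 0])

lemma delta_P_nonneg:
  fixes q :: "int ^ 'd::finite"
  assumes "q \<noteq> 0"
  shows "0 \<le> delta_P q x"
proof -
  have "coprime_ints q \<noteq> {}"
    using exists_near_coprime_int[OF assms] by blast
  then show ?thesis
    unfolding delta_P_def by (intro divide_nonneg_nonneg cINF_greatest) auto
qed

lemma delta_P_le_half:
  fixes q :: "int ^ 'd::finite"
  assumes "q \<noteq> 0"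
  shows "delta_P q x \<le> 1 / 2"
proof -
  obtain p where p: "p \<in> coprime_ints q" "\<bar>rvec q \<bullet> x - of_int p\<bar> \<le> norm (rvec q) / 2"
    using exists_near_coprime_int[OF assms] by blast
  have "delta_P q x \<le> \<bar>rvec q \<bullet> x - of_int p\<bar> / norm (rvec q)"
    using p(1) by (rule delta_P_le)
  also have "\<dots> \<le> 1 / 2"
    using p(2) assms by (simp add: divide_le_eq)
  finally show ?thesis .
qed

text \<open>Only finitely many integers are at most as far from \<open>rvec q \<bullet> x\<close> as
  a fixed admissible \<open>p0\<close>, so the infimum is a minimum.\<close>

lemma delta_P_attained:
  fixes q :: "int ^ 'd::finite"
  assumes "q \<noteq> 0"
  obtains p where "p \<in> coprime_ints q" "delta_P q x = \<bar>rvec q \<bullet> x - of_int p\<bar> / norm (rvec q)"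
proof -
  let ?z = "rvec q \<bullet> x"
  let ?d = "\<lambda>p::int. \<bar>?z - of_int p\<bar>"
  obtain p0 where p0: "p0 \<in> coprime_ints q"
    using exists_near_coprime_int[OF assms] by blast
  define S where "S = {p \<in> coprime_ints q. ?d p \<le> ?d p0}"
  have "S \<subseteq> {\<lfloor>?z - ?d p0\<rfloor>..\<lceil>?z + ?d p0\<rceil>}"
  proof
    fix p assume "p \<in> S"
    then have "?z - ?d p0 \<le> of_int p" "of_int p \<le> ?z + ?d p0"
      unfolding S_def by (simp_all only: mem_Collect_eq) linarith+
    then show "p \<in> {\<lfloor>?z - ?d p0\<rfloor>..\<lceil>?z + ?d p0\<rceil>}"
      by (simp only: atLeastAtMost_iff floor_le_iff le_ceiling_iff) linarith
  qed
  then have "finite S"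
    by (rule finite_subset) simp
  moreover have "S \<noteq> {}"
    using p0 by (auto simp: S_def)
  ultimately obtain p where p: "p \<in> S" "\<And>p'. p' \<in> S \<Longrightarrow> ?d p \<le> ?d p'"
    using arg_min_if_finite[of S ?d] by (metis not_le_imp_less)
  have "?d p \<le> ?d p'" if "p' \<in> coprime_ints q" for p'
    using p that by (cases "p' \<in> S") (auto simp: S_def)
  then have "(INF p\<in>coprime_ints q. ?d p) = ?d p"
    using p(1) by (intro cInf_eq_minimum) (auto simp: S_def)
  then show ?thesis
    using p(1) by (intro that[of p]) (auto simp: S_def delta_P_def)
qed

lemma delta_eq: "delta n x = \<bar>rvec n \<bullet> x - of_int (round (rvec n \<bullet> x))\<bar> / norm (rvec n)"
proof -
  have "(INF k::int. \<bar>rvec n \<bullet> x - of_int k\<bar>) = \<bar>rvec n \<bullet> x - of_int (round (rvec n \<bullet> x))\<bar>"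
    by (intro cInf_eq_minimum) (auto simp: round_diff_minimal)
  then show ?thesis
    by (simp add: delta_def)
qed

lemma delta_pos:
  fixes n :: "int ^ 'd::finite"
  assumes "rvec n \<bullet> x \<notin> \<int>"
  shows "delta n x > 0"
proof -
  have "n \<noteq> 0"
    using assms by auto
  moreover have "rvec n \<bullet> x \<noteq> of_int (round (rvec n \<bullet> x))"
    using assms by (metis Ints_of_int)
  ultimately show ?thesis
    by (simp add: delta_eq)
qed

lemma delta_mult_norm_le: "delta n x * norm (rvec n) \<le> \<bar>rvec n \<bullet> x - of_int k\<bar>"
  using round_diff_minimal[of "rvec n \<bullet> x" k] by (cases "norm (rvec n) = 0") (auto simp: delta_eq)

lemma delta_nonneg: "0 \<le> delta n x"
  by (simp add: delta_eq)

lemma delta_mult_norm_le_half: "delta n x * norm (rvec n) \<le> 1 / 2"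
  using of_int_round_abs_le[of "rvec n \<bullet> x"] delta_mult_norm_le[of n x "round (rvec n \<bullet> x)"]
  by (simp add: abs_minus_commute)

lemma delta_le_inverse_norm: "delta n x \<le> 1 / norm (rvec n)"
proof (cases "norm (rvec n) = 0")
  case False
  then have "0 < norm (rvec n)" by simp
  moreover have "delta n x * norm (rvec n) \<le> 1"
    using delta_mult_norm_le_half[of n x] by linarith
  ultimately show ?thesis
    by (simp only: pos_le_divide_eq)
qed (simp add: delta_eq)

text \<open>Turns a spare power of the distance into decay in the norm of \<open>n\<close>, which
  sparseness makes summable.\<close>

lemma delta_powr_le:
  assumes "\<epsilon> \<ge> 0"
  shows "delta n x powr \<epsilon> \<le> norm (rvec n) powr - \<epsilon>"
proof -
  have "delta n x powr \<epsilon> \<le> (1 / norm (rvec n)) powr \<epsilon>"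
    using assms delta_nonneg delta_le_inverse_norm by (intro powr_mono2)
  then show ?thesis
    by (simp add: powr_divide powr_minus_divide)
qed

lemma delta_le_half:
  fixes n :: "int ^ 'd::finite"
  assumes "n \<noteq> 0"
  shows "delta n x \<le> 1 / 2"
  using mult_left_mono[OF norm_rvec_ge_1[OF assms] delta_nonneg] delta_mult_norm_le_half[of n x]
  by (metis mult.right_neutral order_trans)

text \<open>Translates between quotients of logarithms and power bounds. The inequality turns around
  because \<open>ln D\<close> is negative.\<close>

lemma le_elog_divide_iff:
  assumes "0 < A" "0 < D" "D < 1"
  shows "ereal \<beta> \<le> elog A / elog D \<longleftrightarrow> A \<le> D powr \<beta>"
proof -
  have "ln D < 0"
    using assms by simp
  then have "elog A / elog D = ereal (ln A / ln D)"
    using assms by (simp add: elog_def)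
  moreover have "\<beta> \<le> ln A / ln D \<longleftrightarrow> ln A \<le> ln (D powr \<beta>)"
    using assms \<open>ln D < 0\<close> by (simp add: ln_powr neg_le_divide_eq)
  moreover have "ln A \<le> ln (D powr \<beta>) \<longleftrightarrow> A \<le> D powr \<beta>"
    using assms by (intro ln_le_cancel_iff) auto
  ultimately show ?thesis
    by simp
qed

text \<open>The value of a quotient whose hyperplane contains \<open>x0\<close>: a finite number
  divided by -\<infinity>.\<close>

lemma elog_divide_elog_0: "0 < A \<Longrightarrow> elog A / elog 0 = 0"
  by (simp add: elog_def)

lemma elog_divide_nonneg:
  assumes "0 < A" "A \<le> 1" "0 \<le> D" "D < 1"
  shows "0 \<le> elog A / elog D"
proof (cases "D = 0")
  case False
  then show ?thesis
    using le_elog_divide_iff[of A D 0] assms by (simp add: zero_ereal_def)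
qed (use assms elog_divide_elog_0 in simp)

section \<open>Comparison of the exponents\<close>

text \<open>The jump is at most \<open>2 * C * D powr \<alpha>\<close> with \<open>D\<close> the
  distance to the nearest admissible hyperplane. Lowering the exponent to any \<beta> < \<alpha>
  absorbs the constant. For \<alpha> = 0 it suffices that the quotients are eventually
  nonnegative.\<close>

lemma holder_at_le_Liminf_jump:
  fixes a :: "int ^ 'd::finite \<Rightarrow> real"
  assumes a: "odd_seq a" "(\<lambda>n. \<bar>a n\<bar>) summable_on UNIV"
    and "\<alpha> \<ge> 0" "holder_at \<alpha> (davenport a) x0"
  shows "ereal \<alpha> \<le> Liminf (to_infinity (supp (jump_seq a)))
    (\<lambda>q. elog \<bar>jump_seq a q\<bar> / elog (delta_P q x0))" (is "_ \<le> Liminf ?F ?g")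
proof (cases "\<alpha> = 0")
  case True
  have "\<forall>\<^sub>F q in ?F. 0 < \<bar>jump_seq a q\<bar>"
    unfolding eventually_to_infinity by (auto simp: supp_def)
  then have "\<forall>\<^sub>F q in ?F. 0 \<le> ?g q"
    using eventually_nonzero eventually_jump_seq_less[OF a(2) zero_less_one]
  proof eventually_elim
    case (elim q)
    then show ?case
      using delta_P_le_half[of q x0] by (intro elog_divide_nonneg delta_P_nonneg) auto
  qed
  then show ?thesis
    using True by (simp add: Liminf_bounded flip: zero_ereal_def)
next
  case False
  with \<open>\<alpha> \<ge> 0\<close> have "\<alpha> > 0" by simp
  obtain C P where "C > 0" and P: "poly_degree_less \<alpha> P"
    and "\<forall>\<^sub>F x in nhds x0. \<bar>davenport a x - P x\<bar> \<le> C * norm (x - x0) powr \<alpha>"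
    using assms(4) False unfolding holder_at_def by auto
  then obtain r where "r > 0"
    and r: "\<And>x. dist x x0 < r \<Longrightarrow> \<bar>davenport a x - P x\<bar> \<le> C * norm (x - x0) powr \<alpha>"
    unfolding eventually_nhds_metric by blast
  show ?thesis
    unfolding le_Liminf_iff
  proof (intro allI impI)
    fix y assume "y < ereal \<alpha>"
    then obtain \<beta>' where \<beta>': "y < ereal \<beta>'" "\<beta>' < \<alpha>"
      using ereal_dense2 by (metis ereal_less_eq(3) less_ereal.simps(1))
    \<comment> \<open>The maximum keeps \<beta> positive, so that powers with exponent \<beta> are
      monotone.\<close>
    define \<beta> where "\<beta> = max \<beta>' (\<alpha> / 2)"
    have \<beta>: "y < ereal \<beta>" "\<beta> < \<alpha>" "\<beta> > 0"
      using \<beta>' \<open>\<alpha> > 0\<close> unfolding \<beta>_def by (auto intro: less_le_trans)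
    \<comment> \<open>Chosen so that \<open>D < s\<close> puts \<open>D\<close> inside the range of
      the Hoelder bound and gives
      \<open>2 * C * D powr (\<alpha> - \<beta>) \<le> 1\<close>.\<close>
    define s where "s = min r ((1 / (2 * C)) powr (1 / (\<alpha> - \<beta>)))"
    have "s > 0"
      using \<open>r > 0\<close> \<open>C > 0\<close> by (simp add: s_def)
    have "\<forall>\<^sub>F q in ?F. 0 < \<bar>jump_seq a q\<bar>"
      unfolding eventually_to_infinity by (auto simp: supp_def)
    moreover have "\<forall>\<^sub>F q in ?F. \<bar>jump_seq a q\<bar> < s powr \<beta>"
      using \<open>s > 0\<close> by (intro eventually_jump_seq_less a) simp
    ultimately show "\<forall>\<^sub>F q in ?F. y < ?g q"
      using eventually_nonzero
    proof eventually_elim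
      case (elim q)
      let ?D = "delta_P q x0"
      obtain p where p: "p \<in> coprime_ints q" "?D = \<bar>rvec q \<bullet> x0 - of_int p\<bar> / norm (rvec q)"
        using \<open>q \<noteq> 0\<close> by (rule delta_P_attained)
      have jump: "\<bar>jump_seq a q\<bar> \<le> 2 * C * ?D powr \<alpha>" if "?D < r"
        using abs_jump_seq_le[OF a \<open>q \<noteq> 0\<close> p(1) \<open>\<alpha> > 0\<close> poly_degree_less_continuous_on[OF P] r p(2) that] by simp
      \<comment> \<open>At distance 0 the bound would be \<open>0 powr \<alpha> = 0\<close> and
        force the jump to vanish.\<close>
      have "?D \<noteq> 0"
        using jump elim(1) \<open>r > 0\<close> by auto
      then have "?D > 0"
        using delta_P_nonneg[OF \<open>q \<noteq> 0\<close>, of x0] by simp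
      have "\<bar>jump_seq a q\<bar> \<le> ?D powr \<beta>"
      proof (cases "?D < s")
        case True
        then have "?D powr (\<alpha> - \<beta>) \<le> ((1 / (2 * C)) powr (1 / (\<alpha> - \<beta>))) powr (\<alpha> - \<beta>)"
          using \<open>?D > 0\<close> \<beta> by (intro powr_mono2) (auto simp: s_def)
        also have "\<dots> = 1 / (2 * C)"
          using \<beta> \<open>C > 0\<close> by (simp add: powr_powr)
        finally have "2 * C * ?D powr (\<alpha> - \<beta>) \<le> 1"
          using \<open>C > 0\<close> by (simp add: field_simps)
        then have "(2 * C * ?D powr (\<alpha> - \<beta>)) * ?D powr \<beta> \<le> ?D powr \<beta>"
          by (intro mult_left_le_one_le) (use \<open>C > 0\<close> in auto)
        moreover have "(2 * C * ?D powr (\<alpha> - \<beta>)) * ?D powr \<beta> = 2 * C * ?D powr \<alpha>"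
          by (simp add: powr_add[symmetric])
        ultimately show ?thesis
          using jump True by (simp add: s_def)
      next
        case False
        then have "s powr \<beta> \<le> ?D powr \<beta>"
          using \<open>s > 0\<close> \<beta> by (intro powr_mono2) auto
        then show ?thesis
          using elim by simp
      qed
      then have "ereal \<beta> \<le> ?g q"
        using le_elog_divide_iff[of "\<bar>jump_seq a q\<bar>" ?D \<beta>] elim \<open>?D > 0\<close> delta_P_le_half[OF \<open>q \<noteq> 0\<close>, of x0]
        by simp
      then show ?case
        using \<beta>(1) by simp
    qed
  qed
qed

text \<open>Eventually \<open>max_seq a q\<close> lies strictly between 0 and 1, so its logarithm is
  negative and the upper bound on the quotient is a lower bound on the jump. A zero jump would make
  the quotient \<infinity>.\<close>

lemma eventually_max_seq_powr_le_jump: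
  fixes a :: "int ^ 'd::finite \<Rightarrow> real"
  assumes a: "(\<lambda>n. \<bar>a n\<bar>) summable_on UNIV" and "theta a \<le> 1" "c > 1"
  shows "\<forall>\<^sub>F q in to_infinity (supp (max_seq a)). max_seq a q powr c \<le> \<bar>jump_seq a q\<bar> \<and> jump_seq a q \<noteq> 0"
proof -
  have "theta a < ereal c"
    using assms(2,3) by (metis ereal_less(3) le_less_trans one_ereal_def less_ereal.simps(1))
  then have "\<forall>\<^sub>F q in to_infinity (supp (max_seq a)). elog \<bar>jump_seq a q\<bar> / elog \<bar>max_seq a q\<bar> < ereal c"
    unfolding theta_def by (rule Limsup_lessD)
  moreover have "\<forall>\<^sub>F q in to_infinity (supp (max_seq a)). 0 < max_seq a q"
    unfolding eventually_to_infinity using max_seq_nonneg[OF a] by (auto simp: supp_def less_le)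
  ultimately show ?thesis
    using eventually_max_seq_less[OF a zero_less_one]
  proof eventually_elim
    case (elim q)
    have nz: "jump_seq a q \<noteq> 0"
    proof
      assume "jump_seq a q = 0"
      moreover have "ln (max_seq a q) < 0"
        using elim by simp
      ultimately have "elog \<bar>jump_seq a q\<bar> / elog \<bar>max_seq a q\<bar> = \<infinity>"
        using elim by (simp add: elog_def divide_ereal_def)
      then show False
        using elim(1) by simp
    qed
    have "\<not> ereal c \<le> elog \<bar>jump_seq a q\<bar> / elog (max_seq a q)"
      using elim by (simp add: not_le)
    then have "max_seq a q powr c \<le> \<bar>jump_seq a q\<bar>"
      using le_elog_divide_iff[of "\<bar>jump_seq a q\<bar>" "max_seq a q" c] elim nz by simp
    with nz show ?case by simp
  qed
qed

text \<open>Only finitely many \<open>q\<close> have norm at most \<open>R\<close>. For each, the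
  distance from \<open>rvec q \<bullet> x0\<close> to the integers different from it is bounded
  below, by 1 if that number is itself an integer.\<close>

lemma exists_min_distance_to_other_ints:
  fixes x0 :: "real ^ 'd::finite"
  obtains c where "c > 0"
    "\<And>q p. norm (rvec q) \<le> R \<Longrightarrow> rvec q \<bullet> x0 \<noteq> of_int p \<Longrightarrow> c \<le> \<bar>rvec q \<bullet> x0 - of_int p\<bar>"
proof -
  define m where "m = (\<lambda>z::real. if z \<in> \<int> then 1 else \<bar>z - of_int (round z)\<bar>)"
  have m_pos: "m z > 0" for z
    unfolding m_def by (metis Ints_of_int eq_iff_diff_eq_0 zero_less_abs_iff zero_less_one)
  have m_le: "m z \<le> \<bar>z - of_int p\<bar>" if "z \<noteq> of_int p" for z p
  proof (cases "z \<in> \<int>")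
    case True
    then obtain k where "z = of_int k"
      by (auto elim: Ints_cases)
    moreover from this that have "1 \<le> \<bar>k - p\<bar>"
      by simp
    then have "1 \<le> \<bar>real_of_int k - real_of_int p\<bar>"
      by (metis of_int_1_le_iff of_int_abs of_int_diff)
    ultimately show ?thesis
      by (simp add: m_def)
  qed (simp add: m_def round_diff_minimal)
  define M where "M = insert 1 ((\<lambda>q. m (rvec q \<bullet> x0)) ` {q. norm (rvec q) \<le> R})"
  have "finite M"
    unfolding M_def by (simp add: finite_norm_rvec_le)
  show ?thesis
  proof
    show "Min M > 0"
      using \<open>finite M\<close> m_pos by (auto simp: M_def)
    show "Min M \<le> \<bar>rvec q \<bullet> x0 - of_int p\<bar>"
      if "norm (rvec q) \<le> R" "rvec q \<bullet> x0 \<noteq> of_int p" for q p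
    proof -
      have "Min M \<le> m (rvec q \<bullet> x0)"
        using \<open>finite M\<close> that by (intro Min_le) (auto simp: M_def)
      also have "\<dots> \<le> \<bar>rvec q \<bullet> x0 - of_int p\<bar>"
        using that by (intro m_le)
      finally show ?thesis .
    qed
  qed
qed

text \<open>
  Dividing \<open>n\<close> and the integer nearest to \<open>n \<bullet> x0\<close> by their gcd \<open>g\<close> gives \<open>q\<close> and \<open>p\<close>. As \<open>n\<close> tends to
  infinity so does \<open>q\<close>: for bounded \<open>q\<close> the nonzero numbers \<open>\<bar>q \<bullet> x0 - p\<bar>\<close> stay away from \<open>0\<close>,
  while \<open>g \<bar>q \<bullet> x0 - p\<bar> \<le> 1 / 2\<close>.
\<close>

lemma eventually_reduced_direction:
  fixes x0 :: "real ^ 'd::finite"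
  assumes ev: "\<forall>\<^sub>F q in to_infinity S. Q q"
  shows "\<forall>\<^sub>F n in to_infinity {n. delta n x0 \<noteq> 0}.
    \<exists>g::nat. \<exists>q. g \<ge> 1 \<and> n = int g *s q \<and> q \<noteq> 0 \<and> delta_P q x0 \<le> delta n x0 \<and> (q \<in> S \<longrightarrow> Q q)"
proof -
  obtain R where R: "\<And>q. q \<in> S \<Longrightarrow> R \<le> norm (rvec q) \<Longrightarrow> Q q"
    using ev unfolding eventually_to_infinity by blast
  obtain c where c: "c > 0"
    "\<And>q p. norm (rvec q) \<le> R \<Longrightarrow> rvec q \<bullet> x0 \<noteq> of_int p \<Longrightarrow> c \<le> \<bar>rvec q \<bullet> x0 - of_int p\<bar>"
    using exists_min_distance_to_other_ints[of R x0] by metis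
  \<comment> \<open>The threshold comes from the contradiction below: a \<open>q\<close> of norm at
    most \<open>R\<close> would force \<open>g \<le> 1 / c\<close>, hence
    \<open>norm (rvec n) \<le> \<bar>R\<bar> / c\<close>.\<close>
  have "\<exists>g::nat. \<exists>q. g \<ge> 1 \<and> n = int g *s q \<and> q \<noteq> 0 \<and> delta_P q x0 \<le> delta n x0 \<and> (q \<in> S \<longrightarrow> Q q)"
    if \<delta>: "delta n x0 \<noteq> 0" and n: "\<bar>R\<bar> / c + 1 \<le> norm (rvec n)" for n
  proof -
    have "0 < \<bar>R\<bar> / c + 1"
      using c(1) by (intro add_nonneg_pos) auto
    then have "n \<noteq> 0"
      using n by auto
    then obtain g :: nat and p q where g: "g \<ge> 1" "n = int g *s q"
      "round (rvec n \<bullet> x0) = int g * p" "p \<in> coprime_ints q" "q \<noteq> 0"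
      by (rule reduce_to_coprime)
    have *: "\<bar>rvec n \<bullet> x0 - of_int (round (rvec n \<bullet> x0))\<bar> = real g * \<bar>rvec q \<bullet> x0 - of_int p\<bar>"
      unfolding g(3) unfolding g(2) using g(1)
      by (simp add: rvec_scale abs_mult flip: right_diff_distrib)
    \<comment> \<open>The reduction leaves the hyperplane unchanged, and so its distance from
      \<open>x0\<close>.\<close>
    have \<delta>_eq: "delta n x0 = \<bar>rvec q \<bullet> x0 - of_int p\<bar> / norm (rvec q)"
      unfolding delta_eq * unfolding g(2) using g(1) by (simp add: rvec_scale)
    have "R \<le> norm (rvec q)"
    proof (rule ccontr)
      assume "\<not> R \<le> norm (rvec q)"
      then have "norm (rvec q) \<le> R" by simp
      moreover have "rvec q \<bullet> x0 \<noteq> of_int p"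
        using \<delta> \<delta>_eq by auto
      ultimately have "real g * c \<le> real g * \<bar>rvec q \<bullet> x0 - of_int p\<bar>"
        using c(2) by (intro mult_left_mono) auto
      also have "\<dots> \<le> 1 / 2"
        using * of_int_round_abs_le[of "rvec n \<bullet> x0"] by (simp add: abs_minus_commute)
      finally have "real g \<le> 1 / c"
        using c(1) by (simp add: field_simps)
      then have "real g * norm (rvec q) \<le> 1 / c * \<bar>R\<bar>"
        using \<open>norm (rvec q) \<le> R\<close> c(1) by (intro mult_mono) auto
      then have "norm (rvec n) \<le> \<bar>R\<bar> / c"
        by (simp add: g(2) rvec_scale)
      then show False
        using n by simp
    qed
    moreover have "delta_P q x0 \<le> delta n x0"
      unfolding \<delta>_eq using g(4) by (rule delta_P_le)
    ultimately show ?thesis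
      using g R by blast
  qed
  then show ?thesis
    unfolding eventually_to_infinity by blast
qed

text \<open>For the reduced direction \<open>q\<close> of \<open>n\<close>, the chain is
  \<open>\<bar>a n\<bar> powr (\<beta> / \<gamma>) \<le> max_seq a q powr (\<beta> / \<gamma>) \<le>
  \<bar>jump_seq a q\<bar> \<le> delta_P q x0 powr \<beta> \<le> delta n x0 powr \<beta>\<close>,
  with \<gamma> < \<beta>. If \<open>delta n x0 = 0\<close>, then \<open>q\<close> may stay bounded
  as \<open>n\<close> grows, and bounds valid only for large \<open>q\<close> say nothing.\<close>

lemma Liminf_jump_le_Liminf:
  fixes a :: "int ^ 'd::finite \<Rightarrow> real"
  assumes a: "(\<lambda>n. \<bar>a n\<bar>) summable_on UNIV" and "theta a \<le> 1"
  shows "Liminf (to_infinity (supp (jump_seq a))) (\<lambda>q. elog \<bar>jump_seq a q\<bar> / elog (delta_P q x0))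
    \<le> Liminf (to_infinity {n \<in> supp a. delta n x0 \<noteq> 0}) (\<lambda>n. elog \<bar>a n\<bar> / elog (delta n x0))"
    (is "Liminf ?F ?g \<le> Liminf ?G ?h")
  unfolding le_Liminf_iff
proof (intro allI impI)
  fix y assume "y < Liminf ?F ?g"
  then obtain \<beta> where \<beta>: "y < ereal \<beta>" "ereal \<beta> < Liminf ?F ?g"
    using ereal_dense2 by blast
  have in_G: "\<forall>\<^sub>F n in ?G. n \<in> supp a \<and> delta n x0 \<noteq> 0"
    unfolding eventually_to_infinity by auto
  then have pos: "\<forall>\<^sub>F n in ?G. n \<noteq> 0 \<and> 0 < \<bar>a n\<bar> \<and> \<bar>a n\<bar> < 1 \<and> 0 < delta n x0 \<and> delta n x0 < 1"
    using eventually_nonzero eventually_abs_less[OF a zero_less_one]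
  proof eventually_elim
    case (elim n)
    then show ?case
      using delta_le_half[of n x0] delta_nonneg[of n x0] by (auto simp: supp_def less_le)
  qed
  show "\<forall>\<^sub>F n in ?G. y < ?h n"
  proof (cases "\<beta> \<le> 0")
    case True
    show ?thesis
      using pos
    proof eventually_elim
      case (elim n)
      then have "0 \<le> ?h n"
        by (intro elog_divide_nonneg) auto
      moreover have "ereal \<beta> \<le> 0"
        using True by simp
      ultimately show ?case
        using \<beta>(1) by (meson less_le_trans)
    qed
  next
    case False
    obtain \<gamma>' where \<gamma>': "y < ereal \<gamma>'" "ereal \<gamma>' < ereal \<beta>"
      using ereal_dense2[OF \<beta>(1)] by blast
    \<comment> \<open>Positivity of \<gamma> makes \<open>\<beta> / \<gamma>\<close> an exponent
      above 1, as the use of \<open>theta a \<le> 1\<close> requires.\<close>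
    define \<gamma> where "\<gamma> = max \<gamma>' (\<beta> / 2)"
    have \<gamma>: "y < ereal \<gamma>" "\<gamma> < \<beta>" "\<gamma> > 0"
      using \<gamma>' False unfolding \<gamma>_def by (auto intro: less_le_trans)
    have "\<forall>\<^sub>F q in ?F. ereal \<beta> < ?g q"
      using \<beta>(2) by (rule less_LiminfD)
    then have "\<forall>\<^sub>F q in to_infinity (supp (max_seq a)). jump_seq a q \<noteq> 0 \<longrightarrow> ereal \<beta> < ?g q"
      unfolding eventually_to_infinity by (auto simp: supp_def)
    moreover have "\<forall>\<^sub>F q in to_infinity (supp (max_seq a)).
        max_seq a q powr (\<beta> / \<gamma>) \<le> \<bar>jump_seq a q\<bar> \<and> jump_seq a q \<noteq> 0"
      using \<gamma> by (intro eventually_max_seq_powr_le_jump a assms) simp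
    ultimately have "\<forall>\<^sub>F q in to_infinity (supp (max_seq a)).
        max_seq a q powr (\<beta> / \<gamma>) \<le> \<bar>jump_seq a q\<bar> \<and> jump_seq a q \<noteq> 0 \<and> ereal \<beta> < ?g q"
      by eventually_elim simp
    note eventually_reduced_direction[OF this, of x0]
    then have "\<forall>\<^sub>F n in ?G. \<exists>g::nat. \<exists>q. g \<ge> 1 \<and> n = int g *s q \<and> q \<noteq> 0 \<and> delta_P q x0 \<le> delta n x0 \<and>
        (q \<in> supp (max_seq a) \<longrightarrow>
          max_seq a q powr (\<beta> / \<gamma>) \<le> \<bar>jump_seq a q\<bar> \<and> jump_seq a q \<noteq> 0 \<and> ereal \<beta> < ?g q)"
      by (rule eventually_to_infinity_subset) auto
    with pos show ?thesis
    proof eventually_elim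
      case (elim n)
      then obtain g :: nat and q where g: "g \<ge> 1" "n = int g *s q" "q \<noteq> 0"
        and D: "delta_P q x0 \<le> delta n x0"
        and q: "q \<in> supp (max_seq a) \<Longrightarrow>
          max_seq a q powr (\<beta> / \<gamma>) \<le> \<bar>jump_seq a q\<bar> \<and> jump_seq a q \<noteq> 0 \<and> ereal \<beta> < ?g q"
        by blast
      have le_max: "\<bar>a n\<bar> \<le> max_seq a q"
        unfolding g(2) using g(1) by (intro abs_le_max_seq a)
      then have "q \<in> supp (max_seq a)"
        using elim by (auto simp: supp_def)
      note q = q[OF this]
      \<comment> \<open>Otherwise the quotient would be 0, but it exceeds the positive
        \<beta>.\<close>
      have "delta_P q x0 \<noteq> 0"
      proof
        assume "delta_P q x0 = 0"
        then have "?g q = 0"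
          using q by (simp add: elog_divide_elog_0)
        then show False
          using q False by (simp add: zero_ereal_def)
      qed
      then have D_pos: "0 < delta_P q x0"
        using delta_P_nonneg[OF g(3), of x0] by simp
      have "\<bar>a n\<bar> powr (\<beta> / \<gamma>) \<le> max_seq a q powr (\<beta> / \<gamma>)"
        using le_max \<gamma> by (intro powr_mono2) auto
      also have "\<dots> \<le> \<bar>jump_seq a q\<bar>"
        using q by simp
      also have "\<dots> \<le> delta_P q x0 powr \<beta>"
        using le_elog_divide_iff[of "\<bar>jump_seq a q\<bar>" "delta_P q x0" \<beta>] q D_pos
          delta_P_le_half[OF g(3), of x0] less_imp_le[of "ereal \<beta>" "?g q"] by simp
      also have "\<dots> \<le> delta n x0 powr \<beta>"
        using D D_pos False by (intro powr_mono2) auto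
      finally have "(\<bar>a n\<bar> powr (\<beta> / \<gamma>)) powr (\<gamma> / \<beta>) \<le> (delta n x0 powr \<beta>) powr (\<gamma> / \<beta>)"
        using \<gamma> by (intro powr_mono2) auto
      then have "\<bar>a n\<bar> \<le> delta n x0 powr \<gamma>"
        using \<gamma> elim by (simp add: powr_powr)
      then have "ereal \<gamma> \<le> ?h n"
        using le_elog_divide_iff[of "\<bar>a n\<bar>" "delta n x0" \<gamma>] elim by simp
      then show ?case
        using \<gamma>(1) by simp
    qed
  qed
qed

section \<open>Points of regularity\<close>

lemma pos_vecs_cases:
  fixes q :: "int ^ 'd::{finite,linorder}"
  assumes "q \<noteq> 0"
  shows "q \<in> pos_vecs \<or> - q \<in> pos_vecs"
proof -
  define i where "i = Min {i. q $ i \<noteq> 0}"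
  have "{i. q $ i \<noteq> 0} \<noteq> {}"
    using assms by (auto simp: vec_eq_iff)
  then have "i \<in> {i. q $ i \<noteq> 0}"
    unfolding i_def by (intro Min_in) auto
  moreover have "q $ j = 0" if "j < i" for j
  proof (rule ccontr)
    assume "q $ j \<noteq> 0"
    then have "i \<le> j"
      unfolding i_def by (intro Min_le) auto
    then show False
      using that by simp
  qed
  ultimately show ?thesis
    unfolding pos_vecs_def by (auto intro!: exI[of _ i])
qed

text \<open>If \<open>rvec n \<bullet> x0\<close> were an integer, the reduced pair
  \<open>(p, q)\<close> would give a hyperplane through \<open>x0\<close>, and
  \<open>max_seq a q \<ge> \<bar>a n\<bar> > 0\<close>. Since \<open>disc_set\<close> admits only
  one of \<open>q\<close> and \<open>- q\<close>, the opposite pair, which has the same hyperplane,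
  is treated as well.\<close>

lemma inner_not_Int_of_not_disc_set:
  fixes a :: "int ^ 'd::{finite,linorder} \<Rightarrow> real"
  assumes odd: "odd_seq a" and a: "(\<lambda>n. \<bar>a n\<bar>) summable_on UNIV"
    and x0: "x0 \<notin> disc_set (max_seq a)" and n: "n \<in> supp a"
  shows "rvec n \<bullet> x0 \<notin> \<int>"
proof
  assume "rvec n \<bullet> x0 \<in> \<int>"
  then obtain k where k: "rvec n \<bullet> x0 = of_int k"
    by (auto elim: Ints_cases)
  have "a 0 = - a 0"
    using odd unfolding odd_seq_def by (metis minus_zero)
  then have "n \<noteq> 0"
    using n by (auto simp: supp_def)
  then obtain g :: nat and p q where g: "g \<ge> 1" "n = int g *s q" "k = int g * p" "p \<in> coprime_ints q" "q \<noteq> 0"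
    by (rule reduce_to_coprime)
  have qx: "rvec q \<bullet> x0 = of_int p"
    using k g(1) unfolding g(2,3) by (simp add: rvec_scale)
  have "\<bar>a n\<bar> \<le> max_seq a q"
    unfolding g(2) using g(1) by (intro abs_le_max_seq a)
  then have supp_q: "q \<in> supp (max_seq a)"
    using n by (auto simp: supp_def)
  have "max_seq a (- q) = max_seq a q"
    using odd by (simp add: max_seq_def odd_seq_def)
  then have supp_mq: "- q \<in> supp (max_seq a)"
    using supp_q by (simp add: supp_def)
  have mp: "- p \<in> coprime_ints (- q)"
    using coprime_ints_unit[OF g(4)] by (intro coprime_intsI) auto
  have "x0 \<in> hyperplane p q" "x0 \<in> hyperplane (- p) (- q)"
    using qx by (simp_all add: hyperplane_def rvec_uminus)
  then show False
    using pos_vecs_cases[OF g(5)] x0 supp_q supp_mq g(4) mp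
    unfolding disc_set_def hyp_index_def by blast
qed

text \<open>Decomposition into dyadic shells: the shell of index \<open>i\<close> has at most a
  constant times \<open>2 powr (i * \<epsilon> / 2)\<close> points, each contributing at most
  \<open>2 powr (- i * \<epsilon>)\<close>. The shell sums are dominated by a geometric
  series.\<close>

lemma sparse_set_summable:
  fixes Q :: "(real ^ 'd::finite) set"
  assumes "sparse_set Q" and norm_ge: "\<And>x. x \<in> Q \<Longrightarrow> 1 \<le> norm x" and "\<epsilon> > 0"
  shows "(\<lambda>x. norm x powr - \<epsilon>) summable_on Q"
proof -
  let ?N = "\<lambda>R. card (Q \<inter> ball 0 R)"
  have fin: "finite (Q \<inter> ball 0 R)" for R
    using assms(1) unfolding sparse_set_def by blast
  have "((\<lambda>R. ln (real (?N R)) / ln R) \<longlongrightarrow> 0) at_top"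
    using assms(1) unfolding sparse_set_def by blast
  then have "\<forall>\<^sub>F R in at_top. ln (real (?N R)) / ln R < \<epsilon> / 2"
    using \<open>\<epsilon> > 0\<close> by (intro order_tendstoD(2)) auto
  with eventually_gt_at_top[of 1] have "\<forall>\<^sub>F R in at_top. real (?N R) \<le> R powr (\<epsilon> / 2)"
  proof eventually_elim
    case (elim R)
    show ?case
    \<comment> \<open>For an empty intersection \<open>ln 0 = 0\<close> carries no information, but
      the bound is trivial.\<close>
    proof (cases "?N R = 0")
      case False
      have "ln (real (?N R)) \<le> ln (R powr (\<epsilon> / 2))"
        using elim by (simp add: ln_powr divide_less_eq)
      then show ?thesis
        using False elim by (subst (asm) ln_le_cancel_iff) auto
    qed simp
  qed
  then obtain R0 where R0: "\<And>R. R \<ge> R0 \<Longrightarrow> real (?N R) \<le> R powr (\<epsilon> / 2)"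
    unfolding eventually_at_top_linorder by blast
  \<comment> \<open>Large enough to extend the counting bound from \<open>R \<ge> R0\<close> to all
    \<open>R \<ge> 1\<close>.\<close>
  define M where "M = real (?N R0) + 1"
  have N_le: "real (?N R) \<le> M * R powr (\<epsilon> / 2)" if "R \<ge> 1" for R
  proof (cases "R \<ge> R0")
    case True
    have "R powr (\<epsilon> / 2) \<le> M * R powr (\<epsilon> / 2)"
      by (simp add: M_def distrib_right)
    then show ?thesis
      using R0[OF True] by simp
  next
    case False
    then have "?N R \<le> ?N R0"
      by (intro card_mono fin) auto
    then have "real (?N R) \<le> M * 1"
      by (simp add: M_def)
    also have "\<dots> \<le> M * R powr (\<epsilon> / 2)"
      using that \<open>\<epsilon> > 0\<close> by (intro mult_left_mono ge_one_powr_ge_zero) (auto simp: M_def)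
    finally show ?thesis .
  qed
  define j where "j = (\<lambda>x :: real ^ 'd. nat \<lfloor>log 2 (norm x)\<rfloor>)"
  have j: "2 powr real (j x) \<le> norm x" "norm x < 2 powr (real (j x) + 1)" if "x \<in> Q" for x
  proof -
    have "0 \<le> log 2 (norm x)"
      using norm_ge[OF that] by (intro zero_le_log_cancel_iff[THEN iffD2]) auto
    then have "real (j x) \<le> log 2 (norm x)" "log 2 (norm x) < real (j x) + 1"
      unfolding j_def by auto
    moreover have "0 < norm x"
      using norm_ge[OF that] by linarith
    ultimately show "2 powr real (j x) \<le> norm x" "norm x < 2 powr (real (j x) + 1)"
      by (simp_all only: le_log_iff[of 2] log_less_iff[of 2] one_less_numeral_iff semiring_norm)
  qed
  define t where "t = 2 powr (- (\<epsilon> / 2))"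
  have t: "0 < t" "t < 1"
    using \<open>\<epsilon> > 0\<close> by (auto simp: t_def intro: powr_less_one)
  define K where "K = M * 2 powr (\<epsilon> / 2)"
  have "K \<ge> 0"
    by (simp add: K_def M_def)
  have shell: "(\<Sum>x\<in>{x \<in> F. j x = i}. norm x powr - \<epsilon>) \<le> K * t ^ i" if "F \<subseteq> Q" "finite F" for F i
  proof -
    have "(\<Sum>x\<in>{x \<in> F. j x = i}. norm x powr - \<epsilon>) \<le> (\<Sum>x\<in>{x \<in> F. j x = i}. (2 powr real i) powr - \<epsilon>)"
      using j that \<open>\<epsilon> > 0\<close> by (intro sum_mono powr_mono2') auto
    also have "\<dots> = real (card {x \<in> F. j x = i}) * (2 powr real i) powr - \<epsilon>"
      by simp
    also have "\<dots> \<le> real (?N (2 powr (real i + 1))) * (2 powr real i) powr - \<epsilon>"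
      using j that by (intro mult_right_mono of_nat_mono card_mono fin) auto
    also have "\<dots> \<le> (M * (2 powr (real i + 1)) powr (\<epsilon> / 2)) * (2 powr real i) powr - \<epsilon>"
      by (intro mult_right_mono N_le ge_one_powr_ge_zero) auto
    also have "\<dots> = K * t ^ i"
    proof -
      have t_power: "t ^ i = 2 powr (- (\<epsilon> / 2) * real i)"
        unfolding t_def by (simp add: powr_powr flip: powr_realpow)
      have "(real i + 1) * (\<epsilon> / 2) + real i * - \<epsilon> = \<epsilon> / 2 + - (\<epsilon> / 2) * real i"
        by (simp add: field_simps)
      then show ?thesis
        by (simp only: K_def powr_powr mult.assoc powr_add[symmetric] t_power)
    qed
    finally show ?thesis .
  qed
  show ?thesis
  proof (rule nonneg_bdd_above_summable_on)
    show "bdd_above (sum (\<lambda>x. norm x powr - \<epsilon>) ` {F. F \<subseteq> Q \<and> finite F})"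
    proof (rule bdd_aboveI2)
      fix F assume "F \<in> {F. F \<subseteq> Q \<and> finite F}"
      then have F: "F \<subseteq> Q" "finite F" by auto
      have "(\<Sum>x\<in>F. norm x powr - \<epsilon>) = (\<Sum>i\<in>j ` F. \<Sum>x\<in>{x \<in> F. j x = i}. norm x powr - \<epsilon>)"
        using F by (intro sum.group[symmetric]) auto
      also have "\<dots> \<le> (\<Sum>i\<in>j ` F. K * t ^ i)"
        using F by (intro sum_mono shell)
      also have "\<dots> \<le> (\<Sum>i. K * t ^ i)"
        using F t \<open>K \<ge> 0\<close> by (intro sum_le_suminf summable_mult summable_geometric) auto
      finally show "(\<Sum>x\<in>F. norm x powr - \<epsilon>) \<le> (\<Sum>i. K * t ^ i)" .
    qed
  qed simp
qed

section \<open>Polynomials of degree at most one\<close>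

lemma poly_degree_less_const:
  assumes "\<alpha> > 0"
  shows "poly_degree_less \<alpha> (\<lambda>x :: real ^ 'd::finite. c)"
  unfolding poly_degree_less_def
  using assms by (intro exI[of _ "{\<lambda>_. 0}"] exI[of _ "\<lambda>_. c"]) simp

lemma poly_degree_less_affine:
  fixes w :: "real ^ 'd::finite"
  assumes "\<alpha> > 1"
  shows "poly_degree_less \<alpha> (\<lambda>x. c + w \<bullet> x)"
proof -
  \<comment> \<open>\<open>e i\<close> is the multi-index of the coordinate \<open>x $ i\<close>;
    the zero function is that of the constant term.\<close>
  define e where "e = (\<lambda>i j :: 'd. if j = i then 1 else 0 :: nat)"
  have "inj e"
    by (auto simp: inj_on_def e_def fun_eq_iff split: if_splits)
  have e_nz: "e i \<noteq> (\<lambda>_. 0)" for i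
    by (auto simp: e_def fun_eq_iff)
  define b where "b = (\<lambda>m. if m = (\<lambda>_. 0) then c else w $ (inv e m))"
  have "c + w \<bullet> x = (\<Sum>m\<in>insert (\<lambda>_. 0) (range e). b m * (\<Prod>i\<in>UNIV. (x $ i) ^ m i))" for x
  proof -
    have "(\<Prod>j\<in>UNIV. (x $ j) ^ e i j) = x $ i" for i
    proof -
      have "(\<Prod>j\<in>UNIV. (x $ j) ^ e i j) = (\<Prod>j\<in>UNIV. if j = i then x $ j else 1)"
        by (intro prod.cong) (auto simp: e_def)
      then show ?thesis by simp
    qed
    then have "(\<Sum>m\<in>range e. b m * (\<Prod>i\<in>UNIV. (x $ i) ^ m i)) = (\<Sum>i\<in>UNIV. w $ i * x $ i)"
      using \<open>inj e\<close> e_nz by (subst sum.reindex) (auto simp: b_def)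
    moreover have "(\<lambda>_. 0) \<notin> range e"
      using e_nz by (metis rangeE)
    ultimately show ?thesis
      by (simp add: b_def inner_vec_def)
  qed
  moreover have "real (\<Sum>i\<in>UNIV. m i) < \<alpha>" if "m \<in> insert (\<lambda>_. 0) (range e)" for m
  proof -
    have "(\<Sum>j\<in>UNIV. e i j) = 1" for i
      unfolding e_def by simp
    then show ?thesis
      using that assms by (auto simp del: of_nat_sum)
  qed
  ultimately show ?thesis
    unfolding poly_degree_less_def
    by (intro exI[of _ "insert (\<lambda>_. 0) (range e)"] exI[of _ b]) auto
qed

text \<open>For \<open>D \<le> r\<close> the sawtooth difference and, if \<alpha> > 1, the linear
  term are bounded separately, whence the factor 2. For \<open>D > r\<close> no integer is reached
  and the difference equals the linear term: nothing remains if \<alpha> > 1, and otherwise the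
  linear term itself is small.\<close>

lemma abs_coeff_sawtooth_remainder_le:
  fixes n :: "int ^ 'd::finite"
  assumes "n \<noteq> 0" and D: "D = delta n x0" "D > 0" and A: "\<bar>A\<bar> \<le> B * D powr (\<alpha> + \<epsilon>)" "B \<ge> 0"
    and "\<alpha> > 0" "\<epsilon> > 0" and r: "r = norm (x - x0)" "r > 0"
  shows "\<bar>A * (sawtooth (rvec n \<bullet> x) - sawtooth (rvec n \<bullet> x0) - (if \<alpha> > 1 then rvec n \<bullet> (x - x0) else 0))\<bar>
    \<le> 2 * B * r powr \<alpha> * norm (rvec n) powr - \<epsilon>"
proof -
  let ?n = "norm (rvec n)"
  let ?s = "sawtooth (rvec n \<bullet> x) - sawtooth (rvec n \<bullet> x0)" and ?l = "rvec n \<bullet> (x - x0)"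
  define E where "E = B * r powr \<alpha> * ?n powr - \<epsilon>"
  have "E \<ge> 0"
    using A(2) by (simp add: E_def)
  have n1: "?n \<ge> 1"
    using \<open>n \<noteq> 0\<close> by (rule norm_rvec_ge_1)
  have Dn: "D * ?n \<le> 1"
    using delta_mult_norm_le_half[of n x0] D by simp
  have D_eps: "D powr \<epsilon> \<le> ?n powr - \<epsilon>"
    unfolding D using \<open>\<epsilon> > 0\<close> by (intro delta_powr_le) simp
  have l_le: "\<bar>?l\<bar> \<le> ?n * r"
    unfolding r by (rule Cauchy_Schwarz_ineq2)
  \<comment> \<open>The premise covers both cases where the linear term must be estimated:
    \<open>D \<le> r\<close> with \<alpha> > 1, and \<open>D > r\<close> with \<alpha> \<le> 1. One
    factor \<open>D\<close> compensates the norm of \<open>n\<close>, and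
    \<open>D powr \<epsilon>\<close> gives the decay.\<close>
  have linear: "\<bar>A\<bar> * \<bar>?l\<bar> \<le> E" if "D powr (\<alpha> - 1) \<le> r powr (\<alpha> - 1)"
  proof -
    have "\<bar>A\<bar> * \<bar>?l\<bar> \<le> (B * D powr (\<alpha> + \<epsilon>)) * (?n * r)"
      using A l_le by (intro mult_mono) auto
    also have "\<dots> = B * (D powr (\<alpha> - 1) * D powr \<epsilon> * (D * ?n)) * r"
    proof -
      have "D powr (\<alpha> + \<epsilon>) = D powr (\<alpha> - 1) * D powr \<epsilon> * D powr 1"
        by (simp only: powr_add[symmetric]) simp
      then show ?thesis
        using D by simp
    qed
    also have "\<dots> \<le> B * (r powr (\<alpha> - 1) * ?n powr - \<epsilon> * 1) * r"
      using that D_eps Dn D A(2) r by (intro mult_right_mono mult_left_mono mult_mono) auto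
    also have "\<dots> = B * (r powr (\<alpha> - 1) * r powr 1) * ?n powr - \<epsilon>"
      using r by simp
    also have "\<dots> = E"
      unfolding E_def by (simp only: powr_add[symmetric]) simp
    finally show ?thesis .
  qed
  have "\<bar>A\<bar> * \<bar>?s - (if \<alpha> > 1 then ?l else 0)\<bar> \<le> 2 * E"
  proof (cases "D \<le> r")
    case True
    have "\<bar>A\<bar> * \<bar>?s\<bar> \<le> (B * D powr (\<alpha> + \<epsilon>)) * 1"
      using A abs_sawtooth_diff_le by (intro mult_mono) auto
    also have "\<dots> = B * (D powr \<alpha> * D powr \<epsilon>)"
      by (simp add: powr_add)
    also have "\<dots> \<le> B * (r powr \<alpha> * ?n powr - \<epsilon>)"
      using True D_eps D A(2) \<open>\<alpha> > 0\<close> by (intro mult_left_mono mult_mono powr_mono2) auto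
    finally have s: "\<bar>A\<bar> * \<bar>?s\<bar> \<le> E"
      by (simp add: E_def)
    have l: "\<bar>A\<bar> * \<bar>?l\<bar> \<le> E" if "\<alpha> > 1"
      using that True D by (intro linear powr_mono2) auto
    have "\<bar>A\<bar> * \<bar>?s - (if \<alpha> > 1 then ?l else 0)\<bar> \<le> \<bar>A\<bar> * (\<bar>?s\<bar> + \<bar>if \<alpha> > 1 then ?l else 0\<bar>)"
      by (intro mult_left_mono abs_triangle_ineq4) simp
    also have "\<dots> \<le> 2 * E"
      using s l \<open>E \<ge> 0\<close> by (auto simp: distrib_left)
    finally show ?thesis .
  next
    case False
    have "?s = ?l"
    proof -
      have "\<bar>?l\<bar> < \<bar>rvec n \<bullet> x0 - of_int k\<bar>" for k
      proof -
        have "\<bar>?l\<bar> \<le> r * ?n"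
          using l_le by (simp add: mult.commute)
        also have "\<dots> < D * ?n"
          using False n1 by (intro mult_strict_right_mono) auto
        also have "\<dots> \<le> \<bar>rvec n \<bullet> x0 - of_int k\<bar>"
          unfolding D by (rule delta_mult_norm_le)
        finally show ?thesis .
      qed
      then show ?thesis
        unfolding inner_diff_right by (rule sawtooth_diff)
    qed
    moreover have "\<bar>A\<bar> * \<bar>?l\<bar> \<le> E" if "\<not> \<alpha> > 1"
      using that False r by (intro linear powr_mono2') auto
    ultimately show ?thesis
      using \<open>E \<ge> 0\<close> by auto
  qed
  then show ?thesis
    by (simp add: abs_mult E_def mult.assoc)
qed

text \<open>The approximating polynomial is the sum of the Taylor polynomials of the terms at
  \<open>x0\<close>. The remainders are summable because \<beta> exceeds \<alpha> by a positive
  \<epsilon>.\<close>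

lemma holder_at_davenport:
  fixes a :: "int ^ 'd::finite \<Rightarrow> real"
  assumes a: "(\<lambda>n. \<bar>a n\<bar>) summable_on UNIV" and "a 0 = 0"
    and sparse: "\<And>\<epsilon>. \<epsilon> > 0 \<Longrightarrow> (\<lambda>n. norm (rvec n) powr - \<epsilon>) summable_on supp a"
    and D: "\<And>n. n \<in> supp a \<Longrightarrow> delta n x0 > 0"
    and B: "\<And>n. n \<in> supp a \<Longrightarrow> \<bar>a n\<bar> \<le> B * delta n x0 powr \<beta>" "B \<ge> 0"
    and \<alpha>: "0 < \<alpha>" "\<alpha> < \<beta>"
  shows "holder_at \<alpha> (davenport a) x0"
proof -
  define \<epsilon> where "\<epsilon> = \<beta> - \<alpha>"
  have \<epsilon>: "\<epsilon> > 0" "\<beta> = \<alpha> + \<epsilon>"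
    using \<alpha> by (auto simp: \<epsilon>_def)
  have nz: "n \<noteq> 0" if "n \<in> supp a" for n
    using that \<open>a 0 = 0\<close> by (auto simp: supp_def)
  \<comment> \<open>The termwise gradient at \<open>x0\<close>. For \<alpha> > 1 the series
    converges, its terms being at most \<open>B * norm (rvec n) powr - (\<beta> - 1)\<close> with
    \<beta> > 1.\<close>
  define W where "W = (if \<alpha> > 1 then \<Sum>\<^sub>\<infinity>n\<in>supp a. a n *\<^sub>R rvec n else 0)"
  define L where "L = (\<lambda>x n. if \<alpha> > 1 then rvec n \<bullet> (x - x0) else 0)"
  have W: "((\<lambda>n. a n * L x n) has_sum W \<bullet> (x - x0)) (supp a)" for x
  proof (cases "\<alpha> > 1")
    case True
    have "(\<lambda>n. a n *\<^sub>R rvec n) summable_on supp a"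
    proof (rule abs_summable_summable, rule summable_on_comparison_test)
      show "(\<lambda>n. B * norm (rvec n) powr - (\<beta> - 1)) summable_on supp a"
        using True \<alpha> by (intro summable_on_cmult_right sparse) simp
      fix n assume n: "n \<in> supp a"
      let ?D = "delta n x0" and ?n = "norm (rvec n)"
      have Dn: "?D * ?n \<le> 1"
        using delta_mult_norm_le_half[of n x0] by simp
      have "\<bar>a n\<bar> * ?n \<le> B * ?D powr \<beta> * ?n"
        using B(1)[OF n] by (intro mult_right_mono) auto
      also have "\<dots> = B * (?D powr (\<beta> - 1) * (?D * ?n))"
      proof -
        have "?D powr \<beta> = ?D powr (\<beta> - 1) * ?D powr 1"
          by (simp only: powr_add[symmetric]) simp
        then show ?thesis
          using D[OF n] by simp
      qed
      also have "\<dots> \<le> B * (?n powr - (\<beta> - 1) * 1)"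
        using D[OF n] Dn B(2) True \<alpha> by (intro mult_left_mono mult_mono delta_powr_le) auto
      finally show "norm (a n *\<^sub>R rvec n) \<le> B * ?n powr - (\<beta> - 1)"
        by simp
    qed simp
    then have "((\<lambda>n. a n *\<^sub>R rvec n) has_sum W) (supp a)"
      using True by (simp add: W_def)
    from has_sum_bounded_linear[OF bounded_linear_inner_left this, of "x - x0"] show ?thesis
      using True by (simp add: L_def o_def)
  qed (simp add: L_def W_def)
  define K where "K = (\<Sum>\<^sub>\<infinity>n\<in>supp a. norm (rvec n) powr - \<epsilon>)"
  have "K \<ge> 0"
    unfolding K_def by (rule infsum_nonneg) simp
  define P where "P = (\<lambda>x. (davenport a x0 - W \<bullet> x0) + W \<bullet> x)"
  have P: "poly_degree_less \<alpha> P"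
    unfolding P_def
  proof (cases "\<alpha> > 1")
    case False
    then show "poly_degree_less \<alpha> (\<lambda>x. (davenport a x0 - W \<bullet> x0) + W \<bullet> x)"
      using \<alpha> by (simp add: W_def poly_degree_less_const)
  qed (rule poly_degree_less_affine)
  \<comment> \<open>The summand 1 makes the constant positive also when \<open>B\<close> or
    \<open>K\<close> is 0.\<close>
  have bound: "\<bar>davenport a x - P x\<bar> \<le> (2 * B * K + 1) * norm (x - x0) powr \<alpha>" for x
  proof (cases "x = x0")
    case False
    define r where "r = norm (x - x0)"
    have "r > 0"
      using False by (simp add: r_def)
    let ?s = "\<lambda>n. sawtooth (rvec n \<bullet> x) - sawtooth (rvec n \<bullet> x0)"
    have "(\<lambda>n. a n * ?s n) summable_on supp a"
    proof (rule summable_on_real_comparison[OF summable_on_subset[OF a subset_UNIV]])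
      show "\<bar>a n * ?s n\<bar> \<le> \<bar>a n\<bar>" for n
        using mult_left_mono[OF abs_sawtooth_diff_le, of "\<bar>a n\<bar>"] by (simp add: abs_mult)
    qed
    moreover have "(\<Sum>\<^sub>\<infinity>n\<in>supp a. a n * ?s n) = davenport a x - davenport a x0"
      unfolding davenport_diff[OF a] using nz
      by (intro infsum_cong_neutral) (auto simp: supp_def)
    ultimately have "((\<lambda>n. a n * ?s n) has_sum (davenport a x - davenport a x0)) (supp a)"
      unfolding has_sum_iff by blast
    from has_sum_add[OF this has_sum_uminusI[OF W[of x]]]
    have "((\<lambda>n. a n * (?s n - L x n)) has_sum (davenport a x - P x)) (supp a)"
      by (simp add: P_def algebra_simps)
    moreover have "((\<lambda>n. 2 * B * r powr \<alpha> * norm (rvec n) powr - \<epsilon>) has_sum (2 * B * r powr \<alpha> * K)) (supp a)"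
      unfolding K_def using sparse[OF \<epsilon>(1)] by (intro has_sum_cmult_right) simp
    ultimately have "norm (davenport a x - P x) \<le> 2 * B * r powr \<alpha> * K"
    proof (rule norm_infsum_le)
      fix n assume n: "n \<in> supp a"
      show "norm (a n * (?s n - L x n)) \<le> 2 * B * r powr \<alpha> * norm (rvec n) powr - \<epsilon>"
        unfolding L_def real_norm_def
        using abs_coeff_sawtooth_remainder_le[OF nz[OF n] refl D[OF n] B(1)[OF n, unfolded \<epsilon>(2)] B(2) \<alpha>(1) \<epsilon>(1)
            r_def \<open>r > 0\<close>] .
    qed
    also have "\<dots> \<le> (2 * B * K + 1) * r powr \<alpha>"
      by (simp add: algebra_simps)
    finally show ?thesis
      by (simp add: r_def)
  qed (simp add: P_def)
  have "2 * B * K + 1 > 0"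
    using B(2) \<open>K \<ge> 0\<close> by (intro add_nonneg_pos) auto
  then show ?thesis
    unfolding holder_at_def using P bound \<alpha>(1) by (intro exI[of _ "2 * B * K + 1"] conjI exI[of _ P]) auto
qed

text \<open>The series is bounded, so the zero polynomial, the only one allowed for exponent 0,
  suffices. Hence the Hoelder exponent is nonnegative.\<close>

lemma holder_at_0:
  fixes a :: "int ^ 'd::finite \<Rightarrow> real"
  assumes a: "(\<lambda>n. \<bar>a n\<bar>) summable_on UNIV"
  shows "holder_at 0 (davenport a) x0"
proof -
  have "\<bar>davenport a x\<bar> \<le> (\<Sum>\<^sub>\<infinity>n\<in>UNIV - {0}. \<bar>a n\<bar>)" for x
  proof -
    have "norm (davenport a x) \<le> (\<Sum>\<^sub>\<infinity>n\<in>UNIV - {0}. \<bar>a n\<bar>)"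
      unfolding davenport_def
    proof (rule norm_infsum_le[OF has_sum_infsum has_sum_infsum])
      show "norm (a n * sawtooth (rvec n \<bullet> x)) \<le> \<bar>a n\<bar>" for n
        using mult_left_mono[of "\<bar>sawtooth (rvec n \<bullet> x)\<bar>" 1 "\<bar>a n\<bar>"] abs_sawtooth_le[of "rvec n \<bullet> x"]
        by (simp add: abs_mult)
    qed (intro summable_davenport[OF a] summable_on_subset[OF a] subset_UNIV)+
    then show ?thesis by simp
  qed
  then have "\<bar>davenport a x - 0\<bar> \<le> ((\<Sum>\<^sub>\<infinity>n\<in>UNIV - {0}. \<bar>a n\<bar>) + 1) * 1" for x
    by (simp add: add_increasing2)
  moreover have "(\<Sum>\<^sub>\<infinity>n\<in>UNIV - {0}. \<bar>a n\<bar>) + 1 > 0"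
    by (intro add_nonneg_pos infsum_nonneg) auto
  moreover have "poly_degree_less 0 (\<lambda>_ :: real ^ 'd. 0)"
    unfolding poly_degree_less_def by (intro exI[of _ "{}"]) auto
  ultimately show ?thesis
    unfolding holder_at_def
    by (intro exI[of _ "(\<Sum>\<^sub>\<infinity>n\<in>UNIV - {0}. \<bar>a n\<bar>) + 1"] conjI exI[of _ "\<lambda>_. 0"]) auto
qed

text \<open>Otherwise \<alpha> < \<beta> fit strictly between the exponent and the lower limit. The
  limit gives the power bound with exponent \<beta>, hence regularity of order \<alpha>, a
  contradiction.\<close>

lemma Liminf_le_holder_exponent:
  fixes a :: "int ^ 'd::finite \<Rightarrow> real"
  assumes "odd_seq a" and a: "(\<lambda>n. \<bar>a n\<bar>) summable_on UNIV" and sparse: "sparse_set (rvec ` supp a)"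
    and x0: "\<And>n. n \<in> supp a \<Longrightarrow> rvec n \<bullet> x0 \<notin> \<int>"
  shows "Liminf (to_infinity (supp a)) (\<lambda>n. elog \<bar>a n\<bar> / elog (delta n x0))
    \<le> holder_exponent (davenport a) x0" (is "Liminf ?F ?h \<le> _")
proof -
  have a0: "a 0 = 0"
    using \<open>odd_seq a\<close> unfolding odd_seq_def by (metis minus_zero equation_minus_iff neg_equal_zero)
  have nz: "n \<noteq> 0" if "n \<in> supp a" for n
    using that a0 by (auto simp: supp_def)
  have D: "delta n x0 > 0" if "n \<in> supp a" for n
    using x0[OF that] by (rule delta_pos)
  have summable: "(\<lambda>n. norm (rvec n) powr - \<epsilon>) summable_on supp a" if "\<epsilon> > 0" for \<epsilon>
  proof -
    have "(\<lambda>x. norm x powr - \<epsilon>) summable_on rvec ` supp a"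
      using sparse that norm_rvec_ge_1[OF nz] by (intro sparse_set_summable) auto
    then show ?thesis
      by (simp add: summable_on_reindex inj_on_subset[OF inj_rvec] o_def)
  qed
  show ?thesis
  proof (rule ccontr)
    assume "\<not> Liminf ?F ?h \<le> holder_exponent (davenport a) x0"
    then obtain \<alpha> where \<alpha>: "holder_exponent (davenport a) x0 < ereal \<alpha>" "ereal \<alpha> < Liminf ?F ?h"
      unfolding not_le using ereal_dense2 by blast
    obtain \<beta> where \<beta>: "ereal \<alpha> < ereal \<beta>" "ereal \<beta> < Liminf ?F ?h"
      using ereal_dense2[OF \<alpha>(2)] by blast
    have le_exponent: "ereal \<gamma> \<le> holder_exponent (davenport a) x0"
      if "\<gamma> \<ge> 0" "holder_at \<gamma> (davenport a) x0" for \<gamma>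
      unfolding holder_exponent_def using that by (intro SUP_upper) simp
    have "ereal 0 < ereal \<alpha>"
      using le_exponent[OF order_refl holder_at_0[OF a]] \<alpha>(1) by (rule le_less_trans)
    then have "0 < \<alpha>" by simp
    obtain R where R: "\<And>n. n \<in> supp a \<Longrightarrow> R \<le> norm (rvec n) \<Longrightarrow> ereal \<beta> < ?h n"
      using less_LiminfD[OF \<beta>(2)] unfolding eventually_to_infinity by blast
    define X where "X = {n \<in> supp a. norm (rvec n) \<le> R}"
    have "finite X"
      unfolding X_def by (rule finite_subset[OF _ finite_norm_rvec_le[of R]]) auto
    \<comment> \<open>The bound holds with constant 1 far out; the sum accounts for the finitely
      many remaining \<open>n\<close>, whose distances are positive.\<close>
    define B where "B = 1 + (\<Sum>n\<in>X. \<bar>a n\<bar> / delta n x0 powr \<beta>)"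
    have "B \<ge> 1"
      unfolding B_def by (simp add: sum_nonneg)
    have "\<bar>a n\<bar> \<le> B * delta n x0 powr \<beta>" if n: "n \<in> supp a" for n
    proof (cases "R \<le> norm (rvec n)")
      case True
      have "\<bar>a n\<bar> \<le> delta n x0 powr \<beta>"
        using le_elog_divide_iff[of "\<bar>a n\<bar>" "delta n x0" \<beta>] less_imp_le[OF R[OF n True]] D[OF n] n
          delta_le_half[OF nz[OF n], of x0] by (simp add: supp_def)
      also have "\<dots> \<le> B * delta n x0 powr \<beta>"
        using mult_right_mono[OF \<open>B \<ge> 1\<close>, of "delta n x0 powr \<beta>"] by simp
      finally show ?thesis .
    next
      case False
      then have "n \<in> X"
        using n by (simp add: X_def)
      then have "\<bar>a n\<bar> / delta n x0 powr \<beta> \<le> (\<Sum>n\<in>X. \<bar>a n\<bar> / delta n x0 powr \<beta>)"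
        using \<open>finite X\<close> by (intro member_le_sum) auto
      then have "\<bar>a n\<bar> / delta n x0 powr \<beta> \<le> B"
        by (simp add: B_def)
      then show ?thesis
        using D[OF n] by (simp add: pos_divide_le_eq)
    qed
    then have "holder_at \<alpha> (davenport a) x0"
      using \<open>B \<ge> 1\<close> \<open>0 < \<alpha>\<close> \<beta>(1) by (intro holder_at_davenport[of a _ B \<beta>] a a0 summable D) auto
    then show False
      using le_exponent[of \<alpha>] \<open>0 < \<alpha>\<close> \<alpha>(1) by simp
  qed
qed

theorem theorem1:
  fixes a :: "int ^ 'd::{finite,linorder} \<Rightarrow> real"
  assumes "odd_seq a"
    and "(\<lambda>n. \<bar>a n\<bar>) summable_on UNIV"
    and "sparse_set (rvec ` supp a)"
    and "theta a \<le> 1"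
  shows "\<forall>x0 :: real ^ 'd::{finite,linorder}.
    holder_exponent (davenport a) x0
      \<le> Liminf (to_infinity (supp (jump_seq a)))
          (\<lambda>q. elog \<bar>jump_seq a q\<bar> / elog (delta_P q x0)) \<and>
    Liminf (to_infinity (supp (jump_seq a)))
        (\<lambda>q. elog \<bar>jump_seq a q\<bar> / elog (delta_P q x0))
      \<le> Liminf (to_infinity {n \<in> supp a. delta n x0 \<noteq> 0})
          (\<lambda>n. elog \<bar>a n\<bar> / elog (delta n x0)) \<and>
    (x0 \<notin> disc_set (max_seq a) \<longrightarrow>
      holder_exponent (davenport a) x0
        = Liminf (to_infinity (supp (jump_seq a)))
            (\<lambda>q. elog \<bar>jump_seq a q\<bar> / elog (delta_P q x0)) \<and>
      Liminf (to_infinity (supp (jump_seq a)))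
          (\<lambda>q. elog \<bar>jump_seq a q\<bar> / elog (delta_P q x0))
        = Liminf (to_infinity (supp a))
            (\<lambda>n. elog \<bar>a n\<bar> / elog (delta n x0)))"
proof (intro allI conjI impI)
  fix x0 :: "real ^ 'd::{finite,linorder}"
  let ?h = "holder_exponent (davenport a) x0"
  let ?J = "Liminf (to_infinity (supp (jump_seq a))) (\<lambda>q. elog \<bar>jump_seq a q\<bar> / elog (delta_P q x0))"
  let ?L = "\<lambda>S. Liminf (to_infinity S) (\<lambda>n. elog \<bar>a n\<bar> / elog (delta n x0))"
  show hJ: "?h \<le> ?J"
    unfolding holder_exponent_def
    using holder_at_le_Liminf_jump[OF assms(1,2)] by (intro SUP_least) auto
  show JL: "?J \<le> ?L {n \<in> supp a. delta n x0 \<noteq> 0}"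
    using assms(2,4) by (rule Liminf_jump_le_Liminf)
  assume "x0 \<notin> disc_set (max_seq a)"
  then have nonint: "rvec n \<bullet> x0 \<notin> \<int>" if "n \<in> supp a" for n
    by (rule inner_not_Int_of_not_disc_set[OF assms(1,2) _ that])
  have "delta n x0 \<noteq> 0" if "n \<in> supp a" for n
    using delta_pos[OF nonint[OF that]] by simp
  then have "{n \<in> supp a. delta n x0 \<noteq> 0} = supp a"
    by blast
  with JL have J_le: "?J \<le> ?L (supp a)"
    by simp
  \<comment> \<open>This closes the cycle of inequalities: all distances being positive off the
    discontinuity set, both lower limits over \<open>n\<close> have the same index set.\<close>
  have L_le: "?L (supp a) \<le> ?h"
    using assms(1-3) nonint by (rule Liminf_le_holder_exponent)
  show "?h = ?J"
    using hJ order_trans[OF J_le L_le] by (rule antisym)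
  show "?J = ?L (supp a)"
    using J_le order_trans[OF L_le hJ] by (rule antisym)
qed

end
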